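(* Let $R$ be a Noetherian ring and let $\mathfrak{c}$ be a filtered Floer-Novikov complex over $R$, with Floer chain complex $(C_*(\mathfrak{c}),\partial)$, homology $H_*(\mathfrak{c})$, filtration function $\ell\colon C_*(\mathfrak{c})\to\mathbb{R}\cup\{-\infty\}$ and spectral numbers $\rho(a)$, $a\in H_*(\mathfrak{c})$. Then for any $a\in H_*(\mathfrak{c})$ such that $a\neq 0$, we have $\rho(a)>-\infty$. Further, there is $M\in\mathbb{R}$ such that for any $c\in C_*(\mathfrak{c})$ with $[c]=0$ (i.e. $c$ is a cycle whose homology class in $H_*(\mathfrak{c})$ is zero) there is $h\in C_*(\mathfrak{c})$ with $\partial h=c$ and $\ell(h)\leq \ell(c)+M$.
   Context: Rings are commutative with unit. A filtered Floer-Novikov complex $\mathfrak{c}$ over a ring $R$ consists of the following data. (1) A principal $\Gamma$-bundle $P\to S$ (discrete topology), where $S$ is a finite set and $\Gamma$ is a finitely generated abelian group written multiplicatively; i.e. $P$ is a set with a free $\Gamma$-action whose orbit set is identified with the finite set $S$. (2) An "action functional" $\mathcal{A}\colon P\to\mathbb{R}$ and a "period homomorphism" (group homomorphism) $\omega\colon\Gamma\to\mathbb{R}$ satisfying $\mathcal{A}(g\cdot p)=\mathcal{A}(p)-\omega(g)$ for all $g\in\Gamma$, $p\in P$. (3) A map $n\colon P\times P\to R$ such that: (i) $n(p,p')=0$ unless $\mathcal{A}(p)>\mathcal{A}(p')$; (ii) $n(g\cdot p,g\cdot p')=n(p,p')$ for all $p,p'\in P$, $g\in\Gamma$; (iii)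 for each $p\in P$ the formal sum $\partial p=\sum_{q\in P}n(p,q)q$ belongs to the Floer chain complex $$C_*(\mathfrak{c})=\Big\{\sum_{q\in P}a_q q \;\Big|\; a_q\in R,\ (\forall C\in\mathbb{R})(\#\{q\mid a_q\neq 0,\ \mathcal{A}(q)>C\}<\infty)\Big\};$$ (iv) with the Novikov ring $$\Lambda_{\Gamma,\omega}=\Big\{\sum_{g\in\Gamma}b_g g\;\Big|\; b_g\in R,\ (\forall C\in\mathbb{R})(\#\{g\mid b_g\neq 0,\ \omega(g)<C\}<\infty)\Big\},$$ over which $C_*(\mathfrak{c})$ is a module in the obvious way via the $\Gamma$-action on $P$, the map $\partial\colon P\to C_*(\mathfrak{c})$ of (iii) extends to a $\Lambda_{\Gamma,\omega}$-module homomorphism $\partial\colon C_*(\mathfrak{c})\to C_*(\mathfrak{c})$ with $\partial\circ\partial=0$. Homology: $H_*(\mathfrak{c})=\ker\partial/\operatorname{Im}\partial$. For $c=\sum_{p}c_p p\in C_*(\mathfrak{c})$ nonzero, $\ell(c)=\max\{\mathcal{A}(p)\mid c_p\neq 0\}$ (the maximum exists), and $\ell(0)=-\infty$. For $\lambda\in\mathbb{R}$, $C_*^\lambda(\mathfrak{c})=\{c\in C_*(\mathfrak{c})\mid \ell(c)\le\lambda\}$; by (3)(i) it is preserved by $\partial$, and $H_*^\lambda(\mathfrak{c})$ denotes its homology, with inclusion-induced map $\iota_*\colon H_*^\lambda(\mathfrak{c})\to H_*(\mathfrak{c})$. The spectral number of $a\in H_*(\mathfrak{c})$ is $$\rho(a)=\inf\{\lambda\in\mathbb{R}\mid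 a\in\operatorname{Im}(\iota_*\colon H_*^\lambda(\mathfrak{c})\to H_*(\mathfrak{c}))\}=\inf\{\ell(c)\mid c\in C_*(\mathfrak{c}),\ [c]=a\},$$ where $[c]$ denotes the homology class of the cycle $c$. *)

theory Defs
  imports
    "HOL-Algebra.Group_Action"
    "HOL-Algebra.Generated_Groups"
    "HOL-Algebra.Ring_Divisibility"
    "HOL-Library.Extended_Real"
    "HOL-Library.Function_Algebras"
begin

text \<open>
  The coefficient ring is a type of sort \<open>{comm_ring, comm_monoid_mult}\<close>: a commutative ring
  with unit in which, unlike in \<open>comm_ring_1\<close>, \<open>0 = 1\<close> is allowed. (For the same reason
  \<open>ring_of_type_algebra\<close> of \<open>HOL-Algebra\<close> is not used here.)
\<close>

definition ring_of_type :: "'r::{comm_ring,comm_monoid_mult} ring" where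
  "ring_of_type =
     \<lparr>carrier = UNIV, monoid.mult = (\<lambda>x y. x * y), one = 1, ring.zero = 0, add = (\<lambda>x y. x + y)\<rparr>"

lemma cring_ring_of_type: "cring (ring_of_type :: 'r::{comm_ring,comm_monoid_mult} ring)"
proof -
  have "\<exists>y. y + x = 0" for x :: 'r
    using add.left_inverse by blast
  then show ?thesis
    unfolding ring_of_type_def
    by unfold_locales (auto simp: algebra_simps Units_def)
qed


section \<open>Floer chains and the Novikov ring\<close>

text \<open>A formal sum is the function giving its coefficients, extended by \<open>0\<close> outside the carrier set.\<close>

definition floer_chains :: "'p set \<Rightarrow> ('p \<Rightarrow> real) \<Rightarrow> ('p \<Rightarrow> 'r::zero) set" where
  "floer_chains P A =
     {c. (\<forall>q. c q \<noteq> 0 \<longrightarrow> q \<in> P) \<and> (\<forall>C::real. finite {q. c q \<noteq> 0 \<and> A q > C})}"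

definition novikov_ring :: "('g, 'm) monoid_scheme \<Rightarrow> ('g \<Rightarrow> real) \<Rightarrow> ('g \<Rightarrow> 'r::zero) set" where
  "novikov_ring \<Gamma> \<omega> =
     {b. (\<forall>g. b g \<noteq> 0 \<longrightarrow> g \<in> carrier \<Gamma>) \<and> (\<forall>C::real. finite {g. b g \<noteq> 0 \<and> \<omega> g < C})}"

text \<open>
  \<open>(\<Sum>\<^sub>g b\<^sub>g g) \<cdot> (\<Sum>\<^sub>p c\<^sub>p p) = \<Sum>\<^sub>g\<^sub>,\<^sub>p b\<^sub>g c\<^sub>p (g \<cdot> p)\<close>. For \<open>b\<close> in the Novikov ring and \<open>c\<close> a Floer chain,
  the sum giving each coefficient is finite; see \<open>finite_novikov_smult\<close> below.
\<close>

definition novikov_smult ::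
    "('g \<Rightarrow> 'p \<Rightarrow> 'p) \<Rightarrow> ('g \<Rightarrow> 'r::comm_ring) \<Rightarrow> ('p \<Rightarrow> 'r) \<Rightarrow> ('p \<Rightarrow> 'r)" where
  "novikov_smult act b c =
     (\<lambda>q. \<Sum>(g, p) \<in> {(g, p). b g \<noteq> 0 \<and> c p \<noteq> 0 \<and> act g p = q}. b g * c p)"

definition generator :: "'p \<Rightarrow> 'p \<Rightarrow> 'r::{comm_ring,comm_monoid_mult}" where
  "generator p = (\<lambda>q. if q = p then 1 else 0)"

definition matrix_row :: "'p set \<Rightarrow> ('p \<Rightarrow> 'p \<Rightarrow> 'r::zero) \<Rightarrow> 'p \<Rightarrow> 'p \<Rightarrow> 'r" where
  "matrix_row P n p = (\<lambda>q. if q \<in> P then n p q else 0)"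


section \<open>Filtered Floer-Novikov complexes\<close>

text \<open>
  \<open>\<pi> : P \<rightarrow> S\<close> is the bundle projection. The extension \<open>d\<close> of \<open>p \<mapsto> \<Sum>\<^sub>q n(p,q) q\<close> to a homomorphism
  over the Novikov ring is a parameter rather than asserted to exist; since \<open>S\<close> is finite,
  its values on the Floer chains are determined by \<open>n\<close>. Outside of these sets nothing is required of
  \<open>n\<close>, \<open>A\<close>, \<open>\<omega>\<close>, \<open>d\<close>.
\<close>

locale filtered_floer_novikov_complex =
  comm_group \<Gamma> + group_action \<Gamma> P act
  for \<Gamma> :: "('g, 'm) monoid_scheme" (structure)
    and P :: "'p set"
    and act :: "'g \<Rightarrow> 'p \<Rightarrow> 'p" +
  fixes S :: "'s set"
    and \<pi> :: "'p \<Rightarrow> 's"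
    and A :: "'p \<Rightarrow> real"
    and \<omega> :: "'g \<Rightarrow> real"
    and n :: "'p \<Rightarrow> 'p \<Rightarrow> 'r::{comm_ring,comm_monoid_mult}"
    and d :: "('p \<Rightarrow> 'r) \<Rightarrow> ('p \<Rightarrow> 'r)"
  assumes finitely_generated: "\<exists>F \<subseteq> carrier \<Gamma>. finite F \<and> generate \<Gamma> F = carrier \<Gamma>"
    and free_action: "\<lbrakk>g \<in> carrier \<Gamma>; p \<in> P; act g p = p\<rbrakk> \<Longrightarrow> g = \<one>"
    and finite_base: "finite S"
    and projection_onto: "\<pi> ` P = S"
    and projection_fibres:
      "\<lbrakk>p \<in> P; p' \<in> P\<rbrakk> \<Longrightarrow> \<pi> p = \<pi> p' \<longleftrightarrow> (\<exists>g \<in> carrier \<Gamma>. p' = act g p)"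
    and period_hom:
      "\<lbrakk>g \<in> carrier \<Gamma>; g' \<in> carrier \<Gamma>\<rbrakk> \<Longrightarrow> \<omega> (g \<otimes> g') = \<omega> g + \<omega> g'"
    and action_functional:
      "\<lbrakk>g \<in> carrier \<Gamma>; p \<in> P\<rbrakk> \<Longrightarrow> A (act g p) = A p - \<omega> g"
    and n_decreasing: "\<lbrakk>p \<in> P; p' \<in> P; \<not> A p > A p'\<rbrakk> \<Longrightarrow> n p p' = 0"
    and n_equivariant:
      "\<lbrakk>g \<in> carrier \<Gamma>; p \<in> P; p' \<in> P\<rbrakk> \<Longrightarrow> n (act g p) (act g p') = n p p'"
    and matrix_row_chain: "p \<in> P \<Longrightarrow> matrix_row P n p \<in> floer_chains P A"
    and d_chain: "c \<in> floer_chains P A \<Longrightarrow> d c \<in> floer_chains P A"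
    and d_add:
      "\<lbrakk>c \<in> floer_chains P A; c' \<in> floer_chains P A\<rbrakk> \<Longrightarrow> d (c + c') = d c + d c'"
    and d_smult:
      "\<lbrakk>b \<in> novikov_ring \<Gamma> \<omega>; c \<in> floer_chains P A\<rbrakk>
        \<Longrightarrow> d (novikov_smult act b c) = novikov_smult act b (d c)"
    and d_generator: "p \<in> P \<Longrightarrow> d (generator p) = matrix_row P n p"
    and d_d: "c \<in> floer_chains P A \<Longrightarrow> d (d c) = 0"


section \<open>Filtration, homology and spectral numbers\<close>

definition filtration :: "('p \<Rightarrow> real) \<Rightarrow> ('p \<Rightarrow> 'r::zero) \<Rightarrow> ereal" where
  "filtration A c =
     (if c = 0 then -\<infinity> else ereal (GREATEST x. \<exists>p. c p \<noteq> 0 \<and> x = A p))"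

definition filtered_chains ::
    "'p set \<Rightarrow> ('p \<Rightarrow> real) \<Rightarrow> real \<Rightarrow> ('p \<Rightarrow> 'r::zero) set" where
  "filtered_chains P A lam = {c \<in> floer_chains P A. filtration A c \<le> ereal lam}"

text \<open>
  Homology of a subcomplex \<open>K\<close>. Classes are the cosets of \<open>d ` K\<close> in the cycles of \<open>K\<close>; in particular
  the zero class is \<open>homology_class d K 0\<close>. As cosets for different \<open>K\<close> are different sets, the map
  induced by an inclusion sends a coset \<open>X\<close> to the coset of the larger complex generated by \<open>X\<close>.
\<close>

definition homology_rel :: "('c::{minus,zero} \<Rightarrow> 'c) \<Rightarrow> 'c set \<Rightarrow> 'c rel" where
  "homology_rel d K =
     {(x, y). x \<in> K \<and> y \<in> K \<and> d x = 0 \<and> d y = 0 \<and> x - y \<in> d ` K}"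

definition homology :: "('c::{minus,zero} \<Rightarrow> 'c) \<Rightarrow> 'c set \<Rightarrow> 'c set set" where
  "homology d K = {x \<in> K. d x = 0} // homology_rel d K"

definition homology_class :: "('c::{minus,zero} \<Rightarrow> 'c) \<Rightarrow> 'c set \<Rightarrow> 'c \<Rightarrow> 'c set" where
  "homology_class d K x = homology_rel d K `` {x}"

definition inclusion_induced :: "('c::{minus,zero} \<Rightarrow> 'c) \<Rightarrow> 'c set \<Rightarrow> 'c set \<Rightarrow> 'c set" where
  "inclusion_induced d K X = homology_rel d K `` X"

definition spectral_number ::
    "'p set \<Rightarrow> ('p \<Rightarrow> real) \<Rightarrow> (('p \<Rightarrow> 'r::comm_ring) \<Rightarrow> ('p \<Rightarrow> 'r)) \<Rightarrow> ('p \<Rightarrow> 'r) set \<Rightarrow> ereal" where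
  "spectral_number P A d a =
     Inf {ereal lam | lam::real.
       a \<in> inclusion_induced d (floer_chains P A) ` homology d (filtered_chains P A lam)}"


section \<open>The notions above are well defined\<close>

lemma filtration_Max:
  assumes c: "c \<in> floer_chains P A" and nz: "c \<noteq> 0"
  obtains p where "p \<in> P" "c p \<noteq> 0" "filtration A c = ereal (A p)"
    "\<And>q. c q \<noteq> 0 \<Longrightarrow> A q \<le> A p"
proof -
  from nz obtain p0 where p0: "c p0 \<noteq> 0" by (auto simp: fun_eq_iff)
  let ?F = "{q. c q \<noteq> 0 \<and> A q > A p0 - 1}"
  have fin: "finite ?F" using c by (simp add: floer_chains_def)
  have ne: "p0 \<in> ?F" using p0 by simp
  have "Max (A ` ?F) \<in> A ` ?F" using fin ne by (intro Max_in) auto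
  then obtain p where p: "p \<in> ?F" "Max (A ` ?F) = A p" by auto
  have mx: "A q \<le> A p" if "c q \<noteq> 0" for q
  proof (cases "A q > A p0 - 1")
    case True
    then have "A q \<le> Max (A ` ?F)" using that fin by (intro Max_ge) auto
    then show ?thesis using p by simp
  next
    case False
    then show ?thesis using p by simp
  qed
  have "(GREATEST x. \<exists>p. c p \<noteq> 0 \<and> x = A p) = A p"
    using p mx by (intro Greatest_equality) auto
  then have "filtration A c = ereal (A p)" using nz by (simp add: filtration_def)
  moreover have "p \<in> P" using c p by (auto simp: floer_chains_def)
  ultimately show thesis using that p mx by blast
qed

lemma filtration_le_iff:
  assumes "c \<in> floer_chains P A"
  shows "filtration A c \<le> ereal x \<longleftrightarrow> (\<forall>p. c p \<noteq> 0 \<longrightarrow> A p \<le> x)"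
proof (cases "c = 0")
  case True
  then show ?thesis by (simp add: filtration_def)
next
  case False
  from filtration_Max[OF assms False] obtain p where
    "c p \<noteq> 0" "filtration A c = ereal (A p)" "\<And>q. c q \<noteq> 0 \<Longrightarrow> A q \<le> A p" by metis
  then show ?thesis by (force intro: order_trans)
qed

lemma floer_chains_diff:
  fixes c c' :: "'p \<Rightarrow> 'r::comm_ring"
  assumes "c \<in> floer_chains P A" "c' \<in> floer_chains P A"
  shows "c - c' \<in> floer_chains P A"
proof -
  have "finite {q. (c - c') q \<noteq> 0 \<and> A q > C}" for C
  proof (rule finite_subset)
    show "{q. (c - c') q \<noteq> 0 \<and> A q > C}
        \<subseteq> {q. c q \<noteq> 0 \<and> A q > C} \<union> {q. c' q \<noteq> 0 \<and> A q > C}"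
      by auto
    show "finite ({q. c q \<noteq> 0 \<and> A q > C} \<union> {q. c' q \<noteq> 0 \<and> A q > C})"
      using assms by (simp add: floer_chains_def)
  qed
  moreover have "q \<in> P" if "(c - c') q \<noteq> 0" for q
    using that assms by (cases "c q = 0") (auto simp: floer_chains_def)
  ultimately show ?thesis unfolding floer_chains_def by blast
qed

lemma floer_chains_zero: "0 \<in> floer_chains P A"
  by (simp add: floer_chains_def)

lemma floer_chains_add:
  fixes c c' :: "'p \<Rightarrow> 'r::comm_ring"
  assumes "c \<in> floer_chains P A" "c' \<in> floer_chains P A"
  shows "c + c' \<in> floer_chains P A"
proof -
  have "c + c' = c - (0 - c')" by (simp add: fun_eq_iff)
  then show ?thesis using assms floer_chains_diff floer_chains_zero by metis
qed

context filtered_floer_novikov_complex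
begin

lemma act_in: "\<lbrakk>g \<in> carrier \<Gamma>; p \<in> P\<rbrakk> \<Longrightarrow> act g p \<in> P"
  using element_image by blast

lemma act_cancel:
  assumes "g \<in> carrier \<Gamma>" "g' \<in> carrier \<Gamma>" "p \<in> P" "act g p = act g' p"
  shows "g = g'"
proof -
  have "act (inv g' \<otimes> g) p = act (inv g') (act g p)"
    using assms by (simp add: composition_rule)
  also have "\<dots> = p"
    using assms orbit_sym_aux[of g' p "act g p"] by simp
  finally have "inv g' \<otimes> g = \<one>" using assms free_action by simp
  then show ?thesis using assms
    by (metis inv_equality inv_inv inv_closed)
qed

lemma finite_novikov_smult:
  fixes b :: "'g \<Rightarrow> 'r" and c :: "'p \<Rightarrow> 'r"
  assumes b: "b \<in> novikov_ring \<Gamma> \<omega>" and c: "c \<in> floer_chains P A"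
  shows "finite {(g, p). b g \<noteq> 0 \<and> c p \<noteq> 0 \<and> act g p = q}" (is "finite ?X")
proof (cases "\<exists>g0. b g0 \<noteq> 0")
  case False
  then show ?thesis by simp
next
  case True
  then obtain g0 where g0: "b g0 \<noteq> 0" by blast
  have bc: "b g \<noteq> 0 \<Longrightarrow> g \<in> carrier \<Gamma>" and cP: "c p \<noteq> 0 \<Longrightarrow> p \<in> P" for g p
    using b c by (auto simp: novikov_ring_def floer_chains_def)
  let ?F = "{g. b g \<noteq> 0 \<and> \<omega> g < \<omega> g0 + 1}"
  have fin: "finite ?F" using b by (simp add: novikov_ring_def)
  define m where "m = Min (\<omega> ` ?F)"
  have m0: "m \<le> \<omega> g0" unfolding m_def using fin g0 by (intro Min_le) auto
  have m: "m \<le> \<omega> g" if "b g \<noteq> 0" for g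
  proof (cases "\<omega> g < \<omega> g0 + 1")
    case True
    then show ?thesis unfolding m_def using fin that by (intro Min_le) auto
  next
    case False
    then show ?thesis using m0 by simp
  qed
  let ?Q = "{p. c p \<noteq> 0 \<and> A p > A q + m - 1}"
  have finQ: "finite ?Q" using c by (simp add: floer_chains_def)
  have sub: "snd ` ?X \<subseteq> ?Q"
  proof clarsimp
    fix g p assume gp: "b g \<noteq> 0" "c p \<noteq> 0" "q = act g p"
    then have "A (act g p) = A p - \<omega> g" using action_functional bc cP by blast
    then show "A (act g p) + m - 1 < A p" using m[OF gp(1)] by simp
  qed
  have inj: "inj_on snd ?X"
  proof (rule inj_onI, clarify)
    fix g p g' p'
    assume *: "b g \<noteq> 0" "b g' \<noteq> 0" "c p \<noteq> 0" "act g' p' = act g p" "snd (g, p) = snd (g', p')"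
    then have "act g p = act g' p" by simp
    moreover from * have "g \<in> carrier \<Gamma>" "g' \<in> carrier \<Gamma>" "p \<in> P" "p = p'"
      using bc cP by auto
    ultimately show "g = g' \<and> p = p'" using act_cancel by blast
  qed
  show ?thesis by (rule finite_imageD[OF finite_subset[OF sub finQ] inj])
qed

lemma d_zero: "d 0 = 0"
  using d_add[OF floer_chains_zero floer_chains_zero] by (simp add: fun_eq_iff)

lemma d_diff:
  assumes "c \<in> floer_chains P A" "c' \<in> floer_chains P A"
  shows "d (c - c') = d c - d c'"
proof -
  have "d c = d ((c - c') + c')" by simp
  also have "\<dots> = d (c - c') + d c'" using assms floer_chains_diff d_add by blast
  finally show ?thesis by simp
qed

lemma equiv_homology_rel:
  "equiv {x \<in> floer_chains P A. d x = 0} (homology_rel d (floer_chains P A))"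
proof (intro equivI)
  let ?C = "floer_chains P A"
  show "refl_on {x \<in> ?C. d x = 0} (homology_rel d ?C)"
    using d_zero floer_chains_zero by (force simp: refl_on_def homology_rel_def image_iff)
  show "homology_rel d ?C \<subseteq> {x \<in> ?C. d x = 0} \<times> {x \<in> ?C. d x = 0}"
    by (auto simp: homology_rel_def)
  show "sym (homology_rel d ?C)"
  proof (rule symI)
    fix x y assume xy: "(x, y) \<in> homology_rel d ?C"
    then obtain h where h: "h \<in> ?C" "x - y = d h" by (auto simp: homology_rel_def)
    have "y - x = d (0 - h)" using h d_diff[OF floer_chains_zero h(1)] d_zero
      by (metis diff_0 minus_diff_eq)
    moreover have "0 - h \<in> ?C" using h floer_chains_diff floer_chains_zero by blast
    ultimately show "(y, x) \<in> homology_rel d ?C" using xy by (auto simp: homology_rel_def)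
  qed
  show "trans (homology_rel d ?C)"
  proof (rule transI)
    fix x y z assume xy: "(x, y) \<in> homology_rel d ?C" and yz: "(y, z) \<in> homology_rel d ?C"
    then obtain h k where h: "h \<in> ?C" "x - y = d h" and k: "k \<in> ?C" "y - z = d k"
      by (auto simp: homology_rel_def)
    have "x - z = d (h + k)" using h k d_add[of h k] by (metis diff_add_cancel add_diff_eq)
    moreover have "h + k \<in> ?C" using h k floer_chains_add by blast
    ultimately show "(x, z) \<in> homology_rel d ?C" using xy yz by (auto simp: homology_rel_def)
  qed
qed

lemma filtered_chains_zero: "0 \<in> filtered_chains P A lam"
  by (simp add: filtered_chains_def floer_chains_zero filtration_def)

lemma inclusion_induced_class:
  assumes z: "z \<in> filtered_chains P A lam" "d z = 0"
  shows "inclusion_induced d (floer_chains P A) (homology_class d (filtered_chains P A lam) z)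
    = homology_class d (floer_chains P A) z"
proof -
  let ?C = "floer_chains P A" and ?K = "filtered_chains P A lam"
  have sub: "homology_rel d ?K \<subseteq> homology_rel d ?C"
    by (auto simp: homology_rel_def filtered_chains_def)
  have "(z, z) \<in> homology_rel d ?K"
    using z d_zero filtered_chains_zero by (force simp: homology_rel_def image_iff)
  moreover have "trans (homology_rel d ?C)" using equiv_homology_rel by (simp add: equiv_def)
  ultimately show ?thesis
    unfolding inclusion_induced_def homology_class_def using sub
    by (auto dest: transD)
qed

lemma spectral_number_eq_Inf_filtration:
  assumes a: "a \<in> homology d (floer_chains P A)"
  shows "spectral_number P A d a =
    Inf (filtration A ` {c \<in> floer_chains P A. d c = 0 \<and> homology_class d (floer_chains P A) c = a})"
    (is "_ = Inf (_ ` ?Z)")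
proof -
  let ?C = "floer_chains P A"
  have iff: "a \<in> inclusion_induced d ?C ` homology d (filtered_chains P A lam)
      \<longleftrightarrow> (\<exists>c \<in> ?Z. filtration A c \<le> ereal lam)" (is "?L \<longleftrightarrow> ?R") for lam
  proof -
    let ?K = "filtered_chains P A lam"
    have "?L \<longleftrightarrow> (\<exists>z \<in> ?K. d z = 0 \<and> a = inclusion_induced d ?C (homology_class d ?K z))"
      by (auto simp: homology_def homology_class_def quotient_def)
    also have "\<dots> \<longleftrightarrow> (\<exists>z \<in> ?K. d z = 0 \<and> a = homology_class d ?C z)"
      using inclusion_induced_class by metis
    also have "\<dots> \<longleftrightarrow> ?R" by (auto simp: filtered_chains_def)
    finally show ?thesis .
  qed
  show ?thesis
  proof (rule antisym)
    show "spectral_number P A d a \<le> Inf (filtration A ` ?Z)"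
    proof (rule INF_greatest)
      fix c assume c: "c \<in> ?Z"
      show "spectral_number P A d a \<le> filtration A c"
      proof (rule ereal_le_real)
        fix x assume "filtration A c \<le> ereal x"
        then show "spectral_number P A d a \<le> ereal x"
          unfolding spectral_number_def using iff c by (intro Inf_lower) auto
      qed
    qed
    show "Inf (filtration A ` ?Z) \<le> spectral_number P A d a"
      unfolding spectral_number_def
      by (rule Inf_greatest) (use iff in \<open>auto intro: INF_lower2\<close>)
  qed
qed

end

end

theory Submission
  imports Defs
begin

text \<open>
  Both claims follow from division with remainder in the Floer complex, in the manner of Groebner
  bases. To a chain \<open>c\<close> of filtration level \<open>\<lambda>\<close> belongs its top part, the finite sum of its terms of
  action exactly \<open>\<lambda>\<close>. Top parts of boundaries generate a module of finite sums of elements of \<open>P\<close>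
  over the group ring \<open>R[\<Gamma>]\<close>. As \<open>\<Gamma>\<close> is finitely generated and \<open>S\<close> is finite, Hilbert's basis
  theorem makes this module finitely generated, so finitely many boundaries \<open>d k\<^sub>1, \<dots>, d k\<^sub>m\<close>
  suffice to cancel the top part of every boundary (\<open>uniform_division_step\<close>).
  
  Let \<open>c\<close> be a limit of boundaries, that is, congruent to a boundary modulo chains of arbitrarily low
  level. Its top part is that of a boundary, so it can be cancelled by a combination of the \<open>d k\<^sub>i\<close>,
  and the remainder is again a limit of boundaries. Iterating produces remainders of strictly
  decreasing level. If \<open>\<omega>\<close> has dense image, these levels might accumulate at a finite value; they do not.
  For the combinations used at level \<open>\<lambda>\<close> only introduce terms whose action is \<open>\<lambda>\<close> minus an element of the
  fixed set \<open>D\<close> of gaps between the level of some \<open>d k\<^sub>i\<close> and the actions of its terms. Hence all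
  actions that ever occur are actions in \<open>c\<close> minus sums of elements of \<open>D\<close>, and above any given
  bound there are only finitely many of these (\<open>nonneg_sums_finite\<close>). So the levels tend to \<open>-\<infinity>\<close>,
  the combinations of the \<open>k\<^sub>i\<close> add up to a Floer chain \<open>h\<close>, and \<open>d h = c\<close> because \<open>d\<close> does not raise the
  filtration (\<open>d_below\<close>). At each stage the level of the \<open>k\<^sub>i\<close>-combination exceeds that of the remainder by
  at most \<open>M\<close>, a common bound for the differences between the levels of \<open>k\<^sub>i\<close> and \<open>d k\<^sub>i\<close>. This is
  \<open>boundary_limit_bounded_primitive\<close>.
  
  For a boundary \<open>c\<close> this is the second claim. For the first, a class of spectral number \<open>-\<infinity>\<close> is
  represented by cycles of arbitrarily low level; any fixed representative differs from each of them by
  a boundary, so it is a limit of boundaries, hence a boundary, and the class is zero.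
\<close>

section \<open>Noetherian groups with operators\<close>

text \<open>
  Modules over \<open>R\<close>, \<open>R[x]\<close>, \<open>R[x, y]\<close>, \<dots> are treated uniformly as abelian groups with a
  set \<open>E\<close> of operators. Adjoining a variable to the ring then means adjoining one operator to \<open>E\<close>, and
  no polynomial rings have to be constructed.
\<close>

definition op_closed :: "('a::ab_group_add \<Rightarrow> 'a) set \<Rightarrow> 'a set \<Rightarrow> bool" where
  "op_closed E W \<longleftrightarrow>
     0 \<in> W \<and> (\<forall>a\<in>W. \<forall>b\<in>W. a - b \<in> W) \<and> (\<forall>e\<in>E. \<forall>a\<in>W. e a \<in> W)"

inductive_set op_span :: "('a::ab_group_add \<Rightarrow> 'a) set \<Rightarrow> 'a set \<Rightarrow> 'a set"
  for E X where
  zero: "0 \<in> op_span E X"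
| base: "x \<in> X \<Longrightarrow> x \<in> op_span E X"
| diff: "\<lbrakk>a \<in> op_span E X; b \<in> op_span E X\<rbrakk> \<Longrightarrow> a - b \<in> op_span E X"
| oper: "\<lbrakk>e \<in> E; a \<in> op_span E X\<rbrakk> \<Longrightarrow> e a \<in> op_span E X"

definition noetherian_under :: "('a::ab_group_add \<Rightarrow> 'a) set \<Rightarrow> 'a set \<Rightarrow> bool" where
  "noetherian_under E N \<longleftrightarrow> op_closed E N \<and>
     (\<forall>W. W \<subseteq> N \<longrightarrow> op_closed E W \<longrightarrow> (\<exists>F. finite F \<and> F \<subseteq> W \<and> W \<subseteq> op_span E F))"

lemma op_closedI:
  assumes "0 \<in> W" "\<And>a b. a \<in> W \<Longrightarrow> b \<in> W \<Longrightarrow> a - b \<in> W"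
    "\<And>e a. e \<in> E \<Longrightarrow> a \<in> W \<Longrightarrow> e a \<in> W"
  shows "op_closed E W"
  using assms by (auto simp: op_closed_def)

lemma op_closed_zero: "op_closed E W \<Longrightarrow> 0 \<in> W"
  and op_closed_diff: "\<lbrakk>op_closed E W; a \<in> W; b \<in> W\<rbrakk> \<Longrightarrow> a - b \<in> W"
  and op_closed_oper: "\<lbrakk>op_closed E W; e \<in> E; a \<in> W\<rbrakk> \<Longrightarrow> e a \<in> W"
  by (auto simp: op_closed_def)

lemma op_closed_add: "\<lbrakk>op_closed E W; a \<in> W; b \<in> W\<rbrakk> \<Longrightarrow> a + b \<in> W"
  using op_closed_diff[of E W a "0 - b"] op_closed_diff[of E W 0 b] op_closed_zero by fastforce

lemma op_closed_Int: "\<lbrakk>op_closed E V; op_closed E W\<rbrakk> \<Longrightarrow> op_closed E (V \<inter> W)"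
  unfolding op_closed_def by blast

lemma op_closed_op_span: "op_closed E (op_span E X)"
  by (rule op_closedI) (auto intro: op_span.intros)

lemma op_span_least: "\<lbrakk>X \<subseteq> W; op_closed E W\<rbrakk> \<Longrightarrow> op_span E X \<subseteq> W"
proof
  fix a assume "X \<subseteq> W" "op_closed E W" and "a \<in> op_span E X"
  from this(3,1,2) show "a \<in> W"
    by induction (auto dest: op_closed_zero op_closed_diff op_closed_oper)
qed

lemma op_span_mono: "\<lbrakk>E \<subseteq> E'; X \<subseteq> X'\<rbrakk> \<Longrightarrow> op_span E X \<subseteq> op_span E' X'"
  by (rule op_span_least) (auto intro: op_span.intros op_closedI)

lemma op_span_finite_support:
  assumes "a \<in> op_span E X"
  shows "\<exists>F. finite F \<and> F \<subseteq> X \<and> a \<in> op_span E F"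
  using assms
proof induction
  case zero
  show ?case by (intro exI[of _ "{}"]) (auto intro: op_span.intros)
next
  case (base x)
  then show ?case by (intro exI[of _ "{x}"]) (auto intro: op_span.intros)
next
  case (diff a b)
  then obtain F F' where "finite F" "F \<subseteq> X" "a \<in> op_span E F" "finite F'" "F' \<subseteq> X" "b \<in> op_span E F'"
    by blast
  moreover have "op_span E F \<subseteq> op_span E (F \<union> F')" "op_span E F' \<subseteq> op_span E (F \<union> F')"
    by (intro op_span_mono; blast)+
  ultimately show ?case by (intro exI[of _ "F \<union> F'"]) (auto intro: op_span.diff)
next
  case (oper e a)
  then show ?case by (auto intro: op_span.oper)
qed

text \<open>
  The finitely many generators can be taken from any given generating set \<open>X\<close>, because each of them is
  built from finitely many elements of \<open>X\<close>. The set \<open>X\<close> of top parts of boundaries is not itself closed under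
  subtraction, so this is the form in which the basis theorem is applied.
\<close>

lemma noetherian_under_generators:
  assumes N: "noetherian_under E N" and X: "X \<subseteq> N"
  shows "\<exists>F. finite F \<and> F \<subseteq> X \<and> X \<subseteq> op_span E F"
proof -
  have "op_span E X \<subseteq> N" using N X by (intro op_span_least) (auto simp: noetherian_under_def)
  then obtain G where G: "finite G" "G \<subseteq> op_span E X" "op_span E X \<subseteq> op_span E G"
    using N op_closed_op_span unfolding noetherian_under_def by metis
  have "\<forall>a\<in>G. \<exists>F. finite F \<and> F \<subseteq> X \<and> a \<in> op_span E F"
    using G(2) op_span_finite_support by (metis subsetD)
  then obtain f where f: "\<And>a. a \<in> G \<Longrightarrow> finite (f a) \<and> f a \<subseteq> X \<and> a \<in> op_span E (f a)"
    by metis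
  have "G \<subseteq> op_span E (\<Union> (f ` G))"
  proof
    fix a assume a: "a \<in> G"
    have "op_span E (f a) \<subseteq> op_span E (\<Union> (f ` G))" using a by (intro op_span_mono) auto
    then show "a \<in> op_span E (\<Union> (f ` G))" using f a by blast
  qed
  then have "op_span E G \<subseteq> op_span E (\<Union> (f ` G))"
    by (rule op_span_least) (rule op_closed_op_span)
  moreover have "X \<subseteq> op_span E X" by (auto intro: op_span.base)
  ultimately show ?thesis using f G by (intro exI[of _ "\<Union> (f ` G)"]) auto
qed

text \<open>
  The union of the chain is finitely generated, and all its generators occur at some finite stage.
\<close>

lemma noetherian_under_chain:
  fixes I :: "nat \<Rightarrow> 'a::ab_group_add set"
  assumes N: "noetherian_under E N" and I: "\<And>j. op_closed E (I j)" "\<And>j. I j \<subseteq> N"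
    and mono: "\<And>j. I j \<subseteq> I (Suc j)"
  shows "\<exists>J. \<forall>j. I j \<subseteq> I J"
proof -
  have mono': "i \<le> j \<Longrightarrow> I i \<subseteq> I j" for i j using mono by (rule lift_Suc_mono_le)
  obtain F where F: "finite F" "F \<subseteq> (\<Union>j. I j)" "(\<Union>j. I j) \<subseteq> op_span E F"
    using noetherian_under_generators[OF N, of "\<Union>j. I j"] I(2) by blast
  from F(1,2) have "\<exists>J. F \<subseteq> I J"
  proof (induction F rule: finite_induct)
    case (insert a F)
    then obtain i j where "F \<subseteq> I i" "a \<in> I j" by auto
    then have "insert a F \<subseteq> I (max i j)" using mono'[of i "max i j"] mono'[of j "max i j"] by auto
    then show ?case ..
  qed auto
  then obtain J where "F \<subseteq> I J" ..
  then have "op_span E F \<subseteq> I J" using I(1) by (rule op_span_least)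
  then show ?thesis using F by blast
qed

section \<open>Adjoining an operator\<close>

text \<open>
  The elements \<open>a\<^sub>0 + x a\<^sub>1 + \<dots> + x\<^sup>j\<^sup>-\<^sup>1 a\<^sub>j\<^sub>-\<^sub>1\<close> with coefficients in \<open>N\<close>: polynomials in the
  operator \<open>x\<close> of degree less than \<open>j\<close>, evaluated in the ambient group.
\<close>

primrec operator_polynomials :: "('a::ab_group_add \<Rightarrow> 'a) \<Rightarrow> 'a set \<Rightarrow> nat \<Rightarrow> 'a set" where
  "operator_polynomials x N 0 = {0}"
| "operator_polynomials x N (Suc j) =
     {m + (x ^^ j) a | m a. m \<in> operator_polynomials x N j \<and> a \<in> N}"

text \<open>
  This is the setting of Hilbert's basis theorem. The powers of \<open>x\<close> need not be independent over \<open>N\<close>, so the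
  polynomials generate a quotient of \<open>N[x]\<close> rather than \<open>N[x]\<close> itself.
\<close>

locale commuting_operator =
  fixes E :: "('a::ab_group_add \<Rightarrow> 'a) set" and x :: "'a \<Rightarrow> 'a" and N :: "'a set"
  assumes E_diff: "e \<in> E \<Longrightarrow> e (a - b) = e a - e b"
    and x_diff: "x (a - b) = x a - x b"
    and commute: "e \<in> E \<Longrightarrow> e (x a) = x (e a)"
    and noetherian: "noetherian_under E N"
begin

abbreviation "Pol \<equiv> operator_polynomials x N"

lemma N_closed: "op_closed E N"
  using noetherian by (simp add: noetherian_under_def)

lemma additive_zero: "(\<And>a b. f (a - b) = f a - f b) \<Longrightarrow> f 0 = (0::'a)" for f :: "'a \<Rightarrow> 'a"
  by (metis diff_self)

lemma additive_add: "(\<And>a b. f (a - b) = f a - f b) \<Longrightarrow> f (a + b) = f a + (f b :: 'a)" for f :: "'a \<Rightarrow> 'a"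
  by (metis add_diff_cancel diff_add_cancel)

lemma xpow_diff: "(x ^^ j) (a - b) = (x ^^ j) a - (x ^^ j) b"
  by (induction j) (simp_all add: x_diff)

lemma xpow_commute: "e \<in> E \<Longrightarrow> e ((x ^^ j) a) = (x ^^ j) (e a)"
  by (induction j) (simp_all add: commute)

lemmas xpow_zero = additive_zero[of "x ^^ j" for j, OF xpow_diff]
lemmas x_zero = additive_zero[of x, OF x_diff]
lemmas x_add = additive_add[of x, OF x_diff]

lemma E_zero: "e \<in> E \<Longrightarrow> e 0 = 0"
  using additive_zero[of e] E_diff by blast

lemma E_add: "e \<in> E \<Longrightarrow> e (a + b) = e a + e b"
  using additive_add[of e] E_diff by blast

lemma Pol_closed: "op_closed E (Pol j)"
proof (induction j)
  case 0
  show ?case by (rule op_closedI) (auto simp: E_zero)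
next
  case (Suc j)
  show ?case
  proof (rule op_closedI)
    show "0 \<in> Pol (Suc j)"
      using op_closed_zero[OF Suc] op_closed_zero[OF N_closed] xpow_zero by force
  next
    fix a b assume "a \<in> Pol (Suc j)" "b \<in> Pol (Suc j)"
    then obtain m u m' u' where *: "m \<in> Pol j" "u \<in> N" "a = m + (x ^^ j) u"
      "m' \<in> Pol j" "u' \<in> N" "b = m' + (x ^^ j) u'" by auto
    have "a - b = (m - m') + (x ^^ j) (u - u')" using * by (simp add: xpow_diff)
    moreover have "m - m' \<in> Pol j" "u - u' \<in> N"
      using * op_closed_diff[OF Suc] op_closed_diff[OF N_closed] by blast+
    ultimately show "a - b \<in> Pol (Suc j)" unfolding operator_polynomials.simps by blast
  next
    fix e a assume e: "e \<in> E" and "a \<in> Pol (Suc j)"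
    then obtain m u where *: "m \<in> Pol j" "u \<in> N" "a = m + (x ^^ j) u" by auto
    have "e a = e m + (x ^^ j) (e u)" using * e by (simp add: E_add xpow_commute)
    moreover have "e m \<in> Pol j" "e u \<in> N"
      using * e op_closed_oper[OF Suc] op_closed_oper[OF N_closed] by blast+
    ultimately show "e a \<in> Pol (Suc j)" unfolding operator_polynomials.simps by blast
  qed
qed

lemma Pol_mono: "i \<le> j \<Longrightarrow> Pol i \<subseteq> Pol j"
proof (rule lift_Suc_mono_le[of Pol])
  show "Pol j \<subseteq> Pol (Suc j)" for j
    using op_closed_zero[OF N_closed] xpow_zero by force
qed

lemma Pol_shift: "m \<in> Pol j \<Longrightarrow> x m \<in> Pol (Suc j)"
proof (induction j arbitrary: m)
  case 0
  then show ?case using op_closed_zero[OF Pol_closed[of "Suc 0"]] x_zero by simp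
next
  case (Suc j)
  then obtain m' u where *: "m' \<in> Pol j" "u \<in> N" "m = m' + (x ^^ j) u" by auto
  then have "x m = x m' + (x ^^ Suc j) u" by (simp add: x_add)
  then show ?case using Suc.IH[OF *(1)] * by (simp only: operator_polynomials.simps) blast
qed

lemma Pol_shift_power: "m \<in> Pol j \<Longrightarrow> (x ^^ k) m \<in> Pol (k + j)"
  by (induction k) (auto intro: Pol_shift simp del: operator_polynomials.simps)

text \<open>
  The possible leading coefficients in degree \<open>j\<close> of the elements of \<open>W\<close>. Since the representation of an
  element as a polynomial is not unique, an element may contribute several coefficients.
\<close>

definition leading :: "'a set \<Rightarrow> nat \<Rightarrow> 'a set" where
  "leading W j = {a \<in> N. \<exists>m \<in> Pol j. m + (x ^^ j) a \<in> W}"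

lemma leading_closed:
  assumes W: "op_closed (insert x E) W"
  shows "op_closed E (leading W j)"
proof (rule op_closedI)
  show "0 \<in> leading W j"
    unfolding leading_def using op_closed_zero[OF W] op_closed_zero[OF N_closed]
      op_closed_zero[OF Pol_closed[of j]] xpow_zero by force
next
  fix a b assume "a \<in> leading W j" "b \<in> leading W j"
  then obtain m m' where *: "a \<in> N" "m \<in> Pol j" "m + (x ^^ j) a \<in> W"
      "b \<in> N" "m' \<in> Pol j" "m' + (x ^^ j) b \<in> W"
    by (auto simp: leading_def)
  have "(m - m') + (x ^^ j) (a - b) = (m + (x ^^ j) a) - (m' + (x ^^ j) b)"
    by (simp add: xpow_diff)
  also have "\<dots> \<in> W" using * op_closed_diff[OF W] by blast
  finally show "a - b \<in> leading W j"
    using * op_closed_diff[OF N_closed] op_closed_diff[OF Pol_closed] by (auto simp: leading_def)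
next
  fix e a assume e: "e \<in> E" and "a \<in> leading W j"
  then obtain m where *: "a \<in> N" "m \<in> Pol j" "m + (x ^^ j) a \<in> W"
    by (auto simp: leading_def)
  have "e m + (x ^^ j) (e a) = e (m + (x ^^ j) a)" using e by (simp add: E_add xpow_commute)
  also have "\<dots> \<in> W" using * e op_closed_oper[OF W] by blast
  finally show "e a \<in> leading W j"
    using * e op_closed_oper[OF N_closed] op_closed_oper[OF Pol_closed] by (auto simp: leading_def)
qed

lemma leading_mono:
  assumes W: "op_closed (insert x E) W"
  shows "leading W j \<subseteq> leading W (Suc j)"
proof
  fix a assume "a \<in> leading W j"
  then obtain m where *: "a \<in> N" "m \<in> Pol j" "m + (x ^^ j) a \<in> W"
    by (auto simp: leading_def)
  have "x m + (x ^^ Suc j) a = x (m + (x ^^ j) a)" by (simp add: x_add)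
  also have "\<dots> \<in> W" using * op_closed_oper[OF W] by blast
  finally show "a \<in> leading W (Suc j)"
    using * Pol_shift[OF *(2)] unfolding leading_def by blast
qed

text \<open>
  Hilbert's argument: the leading coefficients in degree \<open>j\<close> increase with \<open>j\<close>, hence are
  constant from some degree \<open>J\<close> on. Generators of the leading coefficients in the degrees up to
  \<open>J\<close>, lifted to \<open>W\<close>, generate \<open>W\<close>, because subtracting a suitable combination of lifts lowers the degree.
\<close>

lemma finitely_generated_by_leading:
  assumes W: "op_closed (insert x E) W" and sub: "W \<subseteq> (\<Union>j. Pol j)"
  shows "\<exists>F. finite F \<and> F \<subseteq> W \<and> W \<subseteq> op_span (insert x E) F"
proof -
  have lN: "leading W j \<subseteq> N" for j by (auto simp: leading_def)
  obtain J where J: "\<And>j. leading W j \<subseteq> leading W J"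
    using noetherian_under_chain[of E N "leading W"] noetherian leading_closed[OF W] lN
      leading_mono[OF W] by blast
  have "\<forall>j. \<exists>F. finite F \<and> F \<subseteq> leading W j \<and> leading W j \<subseteq> op_span E F"
    using noetherian_under_generators[OF noetherian lN] by blast
  then obtain F where F: "\<And>j. finite (F j)" "\<And>j. F j \<subseteq> leading W j"
    "\<And>j. leading W j \<subseteq> op_span E (F j)" by metis
  have "\<forall>j a. \<exists>w. a \<in> F j \<longrightarrow> w \<in> W \<and> w - (x ^^ j) a \<in> Pol j"
  proof (intro allI)
    fix j a
    show "\<exists>w. a \<in> F j \<longrightarrow> w \<in> W \<and> w - (x ^^ j) a \<in> Pol j"
    proof (cases "a \<in> F j")
      case True
      then obtain m where "m \<in> Pol j" "m + (x ^^ j) a \<in> W"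
        using F(2) by (force simp: leading_def)
      then show ?thesis by (intro exI[of _ "m + (x ^^ j) a"]) simp
    qed auto
  qed
  then obtain w where w: "\<And>j a. a \<in> F j \<Longrightarrow> w j a \<in> W \<and> w j a - (x ^^ j) a \<in> Pol j" by metis
  define G where "G = (\<Union>j\<in>{..J}. w j ` F j)"
  let ?S = "op_span (insert x E) G"
  have G: "finite G" "G \<subseteq> W" using F(1) w by (auto simp: G_def)
  have SW: "?S \<subseteq> W" using G(2) W by (rule op_span_least)
  have low: "\<exists>v\<in>?S. v - (x ^^ j) a \<in> Pol j" if "j \<le> J" "a \<in> leading W j" for j a
  proof -
    have "a \<in> op_span E (F j)" using that F(3) by blast
    then show ?thesis
    proof induction
      case zero
      show ?case using op_closed_zero[OF Pol_closed] xpow_zero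
        by (intro bexI[of _ 0]) (auto intro: op_span.zero)
    next
      case (base a)
      then have "w j a \<in> G" using that by (auto simp: G_def)
      then show ?case using w[OF base] by (auto intro: op_span.base)
    next
      case (diff a b)
      then obtain v v' where v: "v \<in> ?S" "v - (x ^^ j) a \<in> Pol j" "v' \<in> ?S" "v' - (x ^^ j) b \<in> Pol j"
        by blast
      have "(v - v') - (x ^^ j) (a - b) = (v - (x ^^ j) a) - (v' - (x ^^ j) b)"
        by (simp add: xpow_diff)
      then show ?case using v op_closed_diff[OF Pol_closed] op_span.diff by metis
    next
      case (oper e a)
      then obtain v where v: "v \<in> ?S" "v - (x ^^ j) a \<in> Pol j" by blast
      have "e v - (x ^^ j) (e a) = e (v - (x ^^ j) a)"
        using oper by (simp add: E_diff xpow_commute)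
      then show ?case using v oper op_closed_oper[OF Pol_closed] op_span.oper
        by (metis insertI2)
    qed
  qed
  have S_pow: "v \<in> ?S \<Longrightarrow> (x ^^ k) v \<in> ?S" for v k
    by (induction k) (auto intro: op_span.oper)
  \<comment> \<open>Beyond degree \<open>J\<close>, shift a lift found in degree \<open>J\<close>.\<close>
  have lift: "\<exists>v\<in>?S. v - (x ^^ j) a \<in> Pol j" if a: "a \<in> leading W j" for j a
  proof (cases "j \<le> J")
    case True
    then show ?thesis using low a by blast
  next
    case False
    then obtain v where v: "v \<in> ?S" "v - (x ^^ J) a \<in> Pol J" using low[of J a] J a by blast
    have "(x ^^ (j - J)) (v - (x ^^ J) a) = (x ^^ (j - J)) v - (x ^^ j) a"
      using False by (simp add: xpow_diff flip: funpow_add[THEN fun_cong, simplified])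
    then show ?thesis using Pol_shift_power[OF v(2), of "j - J"] S_pow[OF v(1)] False
      by (metis le_add_diff_inverse2 nat_le_linear)
  qed
  have "a \<in> W \<Longrightarrow> a \<in> Pol j \<Longrightarrow> a \<in> ?S" for a j
  proof (induction j arbitrary: a)
    case 0
    then show ?case by (simp add: op_span.zero)
  next
    case (Suc j)
    then obtain m u where mu: "m \<in> Pol j" "u \<in> N" "a = m + (x ^^ j) u" by auto
    then have "u \<in> leading W j" using Suc.prems by (auto simp: leading_def)
    then obtain v where v: "v \<in> ?S" "v - (x ^^ j) u \<in> Pol j" using lift by blast
    have "a - v = m - (v - (x ^^ j) u)" using mu by simp
    then have "a - v \<in> Pol j" using mu(1) v(2) op_closed_diff[OF Pol_closed] by metis
    moreover have "a - v \<in> W" using v SW Suc.prems op_closed_diff[OF W] by blast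
    ultimately have "a - v \<in> ?S" using Suc.IH by blast
    then show ?case using op_closed_add[OF op_closed_op_span _ v(1)] by fastforce
  qed
  then have "W \<subseteq> ?S" using sub by (meson UN_E subsetD subsetI)
  then show ?thesis using G by (intro exI[of _ G]) simp
qed

lemma noetherian_adjoin:
  "\<exists>M. N \<subseteq> M \<and> noetherian_under (insert x E) M"
proof (intro exI conjI)
  let ?M = "\<Union>j. Pol j"
  show "N \<subseteq> ?M"
  proof
    fix a assume "a \<in> N"
    then have "a \<in> Pol (Suc 0)" by simp
    then show "a \<in> ?M" by blast
  qed
  have "op_closed (insert x E) ?M"
  proof (rule op_closedI)
    show "0 \<in> ?M" using op_closed_zero[OF Pol_closed] by blast
  next
    fix a b assume "a \<in> ?M" "b \<in> ?M"
    then obtain i j where "a \<in> Pol i" "b \<in> Pol j" by blast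
    then have "a \<in> Pol (max i j)" "b \<in> Pol (max i j)" using Pol_mono[of i "max i j"] Pol_mono[of j "max i j"]
      by auto
    then have "a - b \<in> Pol (max i j)" using op_closed_diff[OF Pol_closed] by blast
    then show "a - b \<in> ?M" by blast
  next
    fix e a assume "e \<in> insert x E" "a \<in> ?M"
    then show "e a \<in> ?M" using op_closed_oper[OF Pol_closed] Pol_shift by blast
  qed
  then show "noetherian_under (insert x E) ?M"
    unfolding noetherian_under_def using finitely_generated_by_leading by blast
qed

end

section \<open>Finite free modules\<close>

definition scale :: "'r::{comm_ring,comm_monoid_mult} \<Rightarrow> ('p \<Rightarrow> 'r) \<Rightarrow> ('p \<Rightarrow> 'r)" where
  "scale r f = (\<lambda>q. r * f q)"

text \<open>
  The ring as a group operated on by its multiplications: the closed subsets are the ideals, and the span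
  of \<open>F\<close> contains the ideal generated by \<open>F\<close>.
\<close>

lemma noetherian_ring_finite_basis:
  fixes I :: "'r::{comm_ring,comm_monoid_mult} set"
  assumes noeth: "noetherian_ring (ring_of_type :: 'r ring)"
    and I: "op_closed (range (*)) I"
  shows "\<exists>F. finite F \<and> F \<subseteq> I \<and> I \<subseteq> op_span (range (*)) F"
proof -
  let ?R = "ring_of_type :: 'r ring"
  interpret R: noetherian_ring ?R by (rule noeth)
  have ideal: "ideal K ?R" if K: "op_closed (range (*)) K" for K
  proof (rule idealI)
    have inv: "inv\<^bsub>add_monoid ?R\<^esub> a = - a" for a
      by (rule group.inv_equality[OF R.add.is_group]) (simp_all add: ring_of_type_def)
    show "subgroup K (add_monoid ?R)"
    proof (rule subgroup.intro)
      show "inv\<^bsub>add_monoid ?R\<^esub> a \<in> K" if "a \<in> K" for a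
        using op_closed_diff[OF K op_closed_zero[OF K] that] inv by simp
    qed (use op_closed_zero[OF K] op_closed_add[OF K] in \<open>auto simp: ring_of_type_def\<close>)
    show "b \<otimes>\<^bsub>?R\<^esub> a \<in> K" if "a \<in> K" for a b
      using op_closed_oper[OF K _ that] by (auto simp: ring_of_type_def)
    then show "a \<otimes>\<^bsub>?R\<^esub> b \<in> K" if "a \<in> K" for a b
      using that by (auto simp: ring_of_type_def mult.commute)
  qed (rule R.ring_axioms)
  obtain F where F: "F \<subseteq> carrier ?R" "finite F" "I = Idl\<^bsub>?R\<^esub> F"
    using R.finetely_gen[OF ideal[OF I]] by blast
  have "F \<subseteq> I" using R.genideal_self[OF F(1)] F(3) by simp
  moreover have "I \<subseteq> op_span (range (*)) F"
    unfolding F(3) by (rule R.genideal_minimal[OF ideal[OF op_closed_op_span]])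
      (auto intro: op_span.base)
  ultimately show ?thesis using F(2) by blast
qed

text \<open>
  Induction on the rank. A submodule is generated by lifts of generators of its ideal of \<open>p\<close>-th coordinates
  together with generators of its elements whose \<open>p\<close>-th coordinate vanishes.
\<close>

lemma noetherian_finite_support:
  fixes Q :: "'p set"
  assumes noeth: "noetherian_ring (ring_of_type :: 'r::{comm_ring,comm_monoid_mult} ring)"
    and Q: "finite Q"
  shows "noetherian_under (range scale) {f :: 'p \<Rightarrow> 'r. \<forall>q. f q \<noteq> 0 \<longrightarrow> q \<in> Q}"
  using Q
proof (induction Q rule: finite_induct)
  case empty
  have "{f :: 'p \<Rightarrow> 'r. \<forall>q. f q \<noteq> 0 \<longrightarrow> q \<in> {}} = {0}" by (auto simp: fun_eq_iff)
  moreover have "noetherian_under (range scale) {0 :: 'p \<Rightarrow> 'r}"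
    unfolding noetherian_under_def
  proof (intro conjI allI impI)
    show "op_closed (range scale) {0 :: 'p \<Rightarrow> 'r}"
      by (rule op_closedI) (auto simp: scale_def fun_eq_iff)
    fix W assume "W \<subseteq> {0 :: 'p \<Rightarrow> 'r}"
    then show "\<exists>F. finite F \<and> F \<subseteq> W \<and> W \<subseteq> op_span (range scale) F"
      by (intro exI[of _ "{}"]) (auto intro: op_span.zero)
  qed
  ultimately show ?case by simp
next
  case (insert p Q)
  let ?N = "\<lambda>Q. {f :: 'p \<Rightarrow> 'r. \<forall>q. f q \<noteq> 0 \<longrightarrow> q \<in> Q}"
  have closed: "op_closed (range scale) (?N Q)" for Q
  proof (rule op_closedI)
    fix f g assume fg: "f \<in> ?N Q" "g \<in> ?N Q"
    have "q \<in> Q" if "(f - g) q \<noteq> 0" for q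
      using that fg by (cases "f q = 0") auto
    then show "f - g \<in> ?N Q" by blast
  next
    fix e :: "('p \<Rightarrow> 'r) \<Rightarrow> ('p \<Rightarrow> 'r)" and f assume "e \<in> range scale" "f \<in> ?N Q"
    then obtain r where "e = scale r" "f \<in> ?N Q" by blast
    moreover have "f q \<noteq> 0" if "r * f q \<noteq> 0" for q using that by (cases "f q = 0") simp_all
    ultimately show "e f \<in> ?N Q" by (simp add: scale_def)
  qed simp
  show ?case unfolding noetherian_under_def
  proof (intro conjI allI impI closed)
    fix W assume WN: "W \<subseteq> ?N (insert p Q)" and W: "op_closed (range scale) W"
    have "op_closed (range scale) (W \<inter> ?N Q)"
      using W closed by (rule op_closed_Int)
    then obtain F where F: "finite F" "F \<subseteq> W \<inter> ?N Q" "W \<inter> ?N Q \<subseteq> op_span (range scale) F"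
      using insert.IH unfolding noetherian_under_def by (meson inf_le2)
    have "op_closed (range (*)) ((\<lambda>f. f p) ` W)"
    proof (rule op_closedI)
      show "0 \<in> (\<lambda>f. f p) ` W" using op_closed_zero[OF W] by (intro image_eqI[of _ _ 0]) simp_all
    next
      fix a b assume "a \<in> (\<lambda>f. f p) ` W" "b \<in> (\<lambda>f. f p) ` W"
      then obtain f g where "f \<in> W" "g \<in> W" "a = f p" "b = g p" by blast
      then show "a - b \<in> (\<lambda>f. f p) ` W" using op_closed_diff[OF W, of f g] by (force intro: rev_image_eqI)
    next
      fix e :: "'r \<Rightarrow> 'r" and a assume "e \<in> range (*)" "a \<in> (\<lambda>f. f p) ` W"
      then obtain r f where "f \<in> W" "a = f p" "e = (*) r" by blast
      then show "e a \<in> (\<lambda>f. f p) ` W" using op_closed_oper[OF W, of "scale r" f]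
        by (auto simp: scale_def intro: rev_image_eqI)
    qed
    then obtain B where B: "finite B" "B \<subseteq> (\<lambda>f. f p) ` W" "(\<lambda>f. f p) ` W \<subseteq> op_span (range (*)) B"
      using noetherian_ring_finite_basis[OF noeth] by blast
    obtain G where G: "G \<subseteq> W" "finite G" "B = (\<lambda>f. f p) ` G"
      using finite_subset_image[OF B(1,2)] by blast
    let ?S = "op_span (range scale) (F \<union> G)"
    have SW: "?S \<subseteq> W" using F(2) G(1) W by (intro op_span_least) auto
    have lift: "\<exists>g\<in>?S. g p = a" if "a \<in> op_span (range (*)) B" for a
      using that
    proof induction
      case zero
      show ?case by (intro bexI[of _ 0]) (auto intro: op_span.zero)
    next
      case (base a)
      then show ?case using G by (auto intro: op_span.base)
    next
      case (diff a b)
      then obtain f g where "f \<in> ?S" "g \<in> ?S" "f p = a" "g p = b" by blast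
      then show ?case by (intro bexI[of _ "f - g"]) (auto intro: op_span.diff)
    next
      case (oper e a)
      then obtain r f where "f \<in> ?S" "f p = a" "e = (*) r" by blast
      then show ?case
        using op_span.oper[of "scale r" "range scale" f] by (intro bexI[of _ "scale r f"]) (simp_all add: scale_def[of r f])
    qed
    have "W \<subseteq> ?S"
    proof
      fix f assume f: "f \<in> W"
      then obtain g where g: "g \<in> ?S" "g p = f p" using lift B(3) by blast
      have "f - g \<in> W" using f g SW op_closed_diff[OF W] by blast
      moreover from this have "f - g \<in> ?N Q" using WN g by fastforce
      ultimately have "f - g \<in> op_span (range scale) F" using F by blast
      then have "f - g \<in> ?S" using op_span_mono[of "range scale" "range scale" F "F \<union> G"] by blast
      then show "f \<in> ?S" using op_closed_add[OF op_closed_op_span _ g(1)] by fastforce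
    qed
    then show "\<exists>F. finite F \<and> F \<subseteq> W \<and> W \<subseteq> op_span (range scale) F"
      using F G by (intro exI[of _ "F \<union> G"]) auto
  qed
qed

section \<open>Translations of Floer chains\<close>

text \<open>
  This evaluates Novikov products that are in fact finite. The index set \<open>Z\<close> may be larger than the set of
  nonzero terms, which avoids distinguishing whether \<open>0 = 1\<close> in the coefficient ring.
\<close>

lemma novikov_smult_eq_sum:
  fixes b :: "'g \<Rightarrow> 'r::comm_ring"
  assumes "finite Z" "\<And>g p. (g, p) \<in> Z \<Longrightarrow> act g p = q"
    and "\<And>g p. \<lbrakk>b g \<noteq> 0; c p \<noteq> 0; act g p = q\<rbrakk> \<Longrightarrow> (g, p) \<in> Z"
  shows "novikov_smult act b c q = (\<Sum>(g, p)\<in>Z. b g * c p)"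
  unfolding novikov_smult_def
proof (rule sum.mono_neutral_left)
  show "\<forall>i\<in>Z - {(g, p). b g \<noteq> 0 \<and> c p \<noteq> 0 \<and> act g p = q}. (case i of (g, p) \<Rightarrow> b g * c p) = 0"
  proof
    fix i assume i: "i \<in> Z - {(g, p). b g \<noteq> 0 \<and> c p \<noteq> 0 \<and> act g p = q}"
    obtain g p where gp: "i = (g, p)" by (cases i)
    then have "b g = 0 \<or> c p = 0" using i assms(2)[of g p] by auto
    then have "b g * c p = 0" by (elim disjE) simp_all
    then show "(case i of (g, p) \<Rightarrow> b g * c p) = 0" using gp by simp
  qed
qed (use assms in auto)

lemma sum_fun_apply: "(\<Sum>i\<in>I. f i) q = (\<Sum>i\<in>I. f i q)"
  for f :: "'i \<Rightarrow> 'p \<Rightarrow> 'r::comm_monoid_add"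
  by (induction I rule: infinite_finite_induct) auto

context filtered_floer_novikov_complex
begin

definition below :: "real \<Rightarrow> ('p \<Rightarrow> 'r) \<Rightarrow> bool" where
  "below L c \<longleftrightarrow> (\<forall>q. c q \<noteq> 0 \<longrightarrow> A q \<le> L)"

definition translate :: "'g \<Rightarrow> ('p \<Rightarrow> 'r) \<Rightarrow> ('p \<Rightarrow> 'r)" where
  "translate g c = (\<lambda>q. if q \<in> P then c (act (inv g) q) else 0)"

lemma act_inv_act: "\<lbrakk>g \<in> carrier \<Gamma>; q \<in> P\<rbrakk> \<Longrightarrow> act (inv g) (act g q) = q"
  using orbit_sym_aux by blast

lemma act_act_inv: "\<lbrakk>g \<in> carrier \<Gamma>; q \<in> P\<rbrakk> \<Longrightarrow> act g (act (inv g) q) = q"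
  using act_inv_act[of "inv g" q] by simp

lemma A_act_inv: "\<lbrakk>g \<in> carrier \<Gamma>; q \<in> P\<rbrakk> \<Longrightarrow> A (act (inv g) q) = A q + \<omega> g"
  using action_functional[of g "act (inv g) q"] act_act_inv[of g q] act_in[of "inv g" q] by simp

lemma translate_diff: "translate g (c - c') = translate g c - translate g c'"
  by (auto simp: translate_def fun_eq_iff)

lemma translate_scale: "scale r (translate g c) = translate g (scale r c)"
  by (auto simp: translate_def scale_def fun_eq_iff)

lemma translate_mult:
  assumes "g \<in> carrier \<Gamma>" "h \<in> carrier \<Gamma>"
  shows "translate (g \<otimes> h) c = translate g (translate h c)"
proof
  fix q
  show "translate (g \<otimes> h) c q = translate g (translate h c) q"
    using assms act_in[of "inv g" q] composition_rule[of q "inv h" "inv g"]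
    by (simp add: translate_def inv_mult_group)
qed

lemma translate_commute:
  assumes "g \<in> carrier \<Gamma>" "h \<in> carrier \<Gamma>"
  shows "translate g (translate h c) = translate h (translate g c)"
  using assms translate_mult m_comm by metis

lemma translate_one:
  assumes "\<And>q. c q \<noteq> 0 \<Longrightarrow> q \<in> P"
  shows "translate \<one> c = c"
proof
  fix q
  show "translate \<one> c q = c q"
    using assms[of q] id_eq_one by (auto simp: translate_def) (metis restrict_apply')+
qed

lemma scale_diff: "scale r (c - c') = scale r c - scale r c'"
  by (auto simp: scale_def fun_eq_iff right_diff_distrib)

lemma scale_nonzero: "scale r c q \<noteq> 0 \<Longrightarrow> c q \<noteq> 0"
  by (cases "c q = 0") (simp_all add: scale_def)

lemma chain_support: "\<lbrakk>c \<in> floer_chains P A; c q \<noteq> 0\<rbrakk> \<Longrightarrow> q \<in> P"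
  by (simp add: floer_chains_def)

lemma chain_finite: "c \<in> floer_chains P A \<Longrightarrow> finite {q. c q \<noteq> 0 \<and> A q > L}"
  by (simp add: floer_chains_def)

lemma scale_chain:
  assumes "c \<in> floer_chains P A"
  shows "scale r c \<in> floer_chains P A"
proof -
  have "finite {q. scale r c q \<noteq> 0 \<and> A q > L}" for L
    by (rule finite_subset[OF _ chain_finite[OF assms, of L]]) (auto dest: scale_nonzero)
  moreover have "q \<in> P" if "scale r c q \<noteq> 0" for q
    by (rule chain_support[OF assms scale_nonzero[OF that]])
  ultimately show ?thesis unfolding floer_chains_def by simp
qed

lemma translate_nonzero:
  assumes "g \<in> carrier \<Gamma>" "translate g c q \<noteq> 0"
  obtains "q \<in> P" "c (act (inv g) q) \<noteq> 0" "A (act (inv g) q) = A q + \<omega> g"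
  using assms A_act_inv by (auto simp: translate_def split: if_splits)

lemma translate_chain:
  assumes g: "g \<in> carrier \<Gamma>" and c: "c \<in> floer_chains P A"
  shows "translate g c \<in> floer_chains P A"
proof -
  have "finite {q. translate g c q \<noteq> 0 \<and> A q > L}" for L
  proof (rule finite_subset)
    show "{q. translate g c q \<noteq> 0 \<and> A q > L} \<subseteq> act g ` {q. c q \<noteq> 0 \<and> A q > L + \<omega> g}"
    proof clarify
      fix q assume q: "translate g c q \<noteq> 0" "A q > L"
      from g q(1) show "q \<in> act g ` {q. c q \<noteq> 0 \<and> A q > L + \<omega> g}"
      proof (rule translate_nonzero)
        assume "q \<in> P" "c (act (inv g) q) \<noteq> 0" "A (act (inv g) q) = A q + \<omega> g"
        then show ?thesis using q act_act_inv[OF g] by (intro image_eqI[of _ _ "act (inv g) q"]) auto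
      qed
    qed
    show "finite (act g ` {q. c q \<noteq> 0 \<and> A q > L + \<omega> g})" using chain_finite[OF c] by blast
  qed
  then show ?thesis by (auto simp: floer_chains_def translate_def split: if_splits)
qed

lemma novikov_smult_monomial:
  assumes g: "g \<in> carrier \<Gamma>" and c: "c \<in> floer_chains P A"
  shows "novikov_smult act (\<lambda>x. if x = g then r else 0) c = scale r (translate g c)"
proof
  fix q
  show "novikov_smult act (\<lambda>x. if x = g then r else 0) c q = scale r (translate g c) q"
  proof (cases "q \<in> P")
    case True
    have "novikov_smult act (\<lambda>x. if x = g then r else 0) c q
        = (\<Sum>(x, p)\<in>{(g, act (inv g) q)}. (if x = g then r else 0) * c p)"
      by (rule novikov_smult_eq_sum)
        (use True act_act_inv[OF g] act_inv_act[OF g] chain_support[OF c] in \<open>auto split: if_splits\<close>)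
    then show ?thesis using True by (simp add: scale_def translate_def)
  next
    case False
    have "novikov_smult act (\<lambda>x. if x = g then r else 0) c q
        = (\<Sum>(x, p)\<in>{}. (if x = g then r else 0) * c p)"
      by (rule novikov_smult_eq_sum)
        (use False g act_in chain_support[OF c] in \<open>auto split: if_splits\<close>)
    then show ?thesis using False by (simp add: scale_def translate_def)
  qed
qed

text \<open>
  Linearity over the Novikov ring, applied to the monomial \<open>r g\<close>.
\<close>

lemma d_monomial:
  assumes g: "g \<in> carrier \<Gamma>" and c: "c \<in> floer_chains P A"
  shows "d (scale r (translate g c)) = scale r (translate g (d c))"
proof -
  let ?b = "\<lambda>x. if x = g then r else 0"
  have "?b \<in> novikov_ring \<Gamma> \<omega>"
    unfolding novikov_ring_def using g by (auto intro: finite_subset[of _ "{g}"])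
  then have "d (novikov_smult act ?b c) = novikov_smult act ?b (d c)"
    using c by (rule d_smult)
  then show ?thesis by (simp only: novikov_smult_monomial[OF g c] novikov_smult_monomial[OF g d_chain[OF c]])
qed

lemma scale_one: "scale 1 c = c"
  by (simp add: scale_def)

lemma d_translate:
  "\<lbrakk>g \<in> carrier \<Gamma>; c \<in> floer_chains P A\<rbrakk> \<Longrightarrow> d (translate g c) = translate g (d c)"
  using d_monomial[of g c 1] by (simp add: scale_one)

lemma d_scale:
  assumes c: "c \<in> floer_chains P A"
  shows "d (scale r c) = scale r (d c)"
proof -
  have "translate \<one> c = c" "translate \<one> (d c) = d c"
    by (rule translate_one, erule chain_support[OF c])
      (rule translate_one, erule chain_support[OF d_chain[OF c]])
  then show ?thesis using d_monomial[OF one_closed c, of r] by simp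
qed

section \<open>The differential does not raise the filtration\<close>

lemma d_sum:
  assumes "finite I" "\<And>i. i \<in> I \<Longrightarrow> f i \<in> floer_chains P A"
  shows "(\<Sum>i\<in>I. f i) \<in> floer_chains P A \<and> d (\<Sum>i\<in>I. f i) = (\<Sum>i\<in>I. d (f i))"
  using assms
proof (induction I rule: finite_induct)
  case empty
  show ?case unfolding sum.empty using floer_chains_zero d_zero by blast
next
  case (insert i I)
  then have IH: "sum f I \<in> floer_chains P A" "d (sum f I) = (\<Sum>i\<in>I. d (f i))"
    and fi: "f i \<in> floer_chains P A" by blast+
  show ?case
    unfolding sum.insert[OF insert.hyps] IH(2)[symmetric]
    using floer_chains_add[OF fi IH(1)] d_add[OF fi IH(1)] by blast
qed

lemma generator_chain: "p \<in> P \<Longrightarrow> generator p \<in> floer_chains P A"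
  by (auto simp: floer_chains_def generator_def intro: finite_subset[of _ "{p}"])

text \<open>
  A chain is \<open>\<Sum>\<^sub>s b\<^sub>s p\<^sub>s\<close> for one point \<open>p\<^sub>s\<close> in each of the finitely many orbits and Novikov
  coefficients \<open>b\<^sub>s\<close>. Hence \<open>d\<close> is determined by the matrix \<open>n\<close> also on infinite sums.
\<close>

lemma chain_decomposition:
  assumes c: "c \<in> floer_chains P A" and p: "\<And>s. s \<in> S \<Longrightarrow> p s \<in> P \<and> \<pi> (p s) = s"
  defines "b \<equiv> \<lambda>s g. if g \<in> carrier \<Gamma> then c (act g (p s)) else 0"
  shows "\<And>s. s \<in> S \<Longrightarrow> b s \<in> novikov_ring \<Gamma> \<omega>"
    and "d c = (\<Sum>s\<in>S. novikov_smult act (b s) (matrix_row P n (p s)))"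
proof -
  show b: "b s \<in> novikov_ring \<Gamma> \<omega>" if s: "s \<in> S" for s
  proof -
    have "finite {g. b s g \<noteq> 0 \<and> \<omega> g < L}" (is "finite ?G") for L
    proof (rule finite_imageD)
      have "(\<lambda>g. act g (p s)) ` ?G \<subseteq> {q. c q \<noteq> 0 \<and> A q > A (p s) - L}"
        using p[OF s] action_functional by (auto simp: b_def split: if_splits)
      then show "finite ((\<lambda>g. act g (p s)) ` ?G)" using chain_finite[OF c] finite_subset by blast
      show "inj_on (\<lambda>g. act g (p s)) ?G"
        using p[OF s] act_cancel by (intro inj_onI) (auto simp: b_def split: if_splits)
    qed
    then show ?thesis by (auto simp: novikov_ring_def b_def split: if_splits)
  qed
  have part: "novikov_smult act (b s) (generator (p s)) = (\<lambda>q. if q \<in> P \<and> \<pi> q = s then c q else 0)"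
    if s: "s \<in> S" for s
  proof
    fix q
    show "novikov_smult act (b s) (generator (p s)) q = (if q \<in> P \<and> \<pi> q = s then c q else 0)"
    proof (cases "q \<in> P \<and> \<pi> q = s")
      case True
      then obtain g where g: "g \<in> carrier \<Gamma>" "q = act g (p s)"
        using p[OF s] projection_fibres[of "p s" q] by auto
      have "novikov_smult act (b s) (generator (p s)) q
          = (\<Sum>(g, p')\<in>{(g, p s)}. b s g * generator (p s) p')"
        by (rule novikov_smult_eq_sum)
          (use g p[OF s] act_cancel in \<open>auto simp: b_def generator_def split: if_splits\<close>)
      then show ?thesis using True g by (simp add: b_def generator_def)
    next
      case False
      have "novikov_smult act (b s) (generator (p s)) q
          = (\<Sum>(g, p')\<in>{}. b s g * generator (p s) p')"
      proof (rule novikov_smult_eq_sum)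
        fix g p' assume *: "b s g \<noteq> 0" "generator (p s) p' \<noteq> (0::'r)" "act g p' = q"
        then have "g \<in> carrier \<Gamma>" "p' = p s" by (auto simp: b_def generator_def split: if_splits)
        then have "q \<in> P \<and> \<pi> q = s"
          using * p[OF s] act_in projection_fibres[of "p s" q] by auto
        with False show "(g, p') \<in> {}" by blast
      qed auto
      then show ?thesis using False by auto
    qed
  qed
  have chain: "novikov_smult act (b s) (generator (p s)) \<in> floer_chains P A" if "s \<in> S" for s
  proof -
    have "finite {q. (if q \<in> P \<and> \<pi> q = s then c q else 0) \<noteq> 0 \<and> A q > L}" for L
      by (rule finite_subset[OF _ chain_finite[OF c, of L]]) auto
    then show ?thesis unfolding part[OF that] by (auto simp: floer_chains_def)
  qed
  have "c = (\<Sum>s\<in>S. novikov_smult act (b s) (generator (p s)))"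
  proof
    fix q
    have "(\<Sum>s\<in>S. novikov_smult act (b s) (generator (p s))) q
        = (\<Sum>s\<in>S. if q \<in> P \<and> \<pi> q = s then c q else 0)"
      by (simp add: sum_fun_apply part)
    also have "\<dots> = c q"
    proof (cases "q \<in> P")
      case True
      then have "\<pi> q \<in> S" using projection_onto by blast
      then show ?thesis using True finite_base by simp
    next
      case False
      then show ?thesis using chain_support[OF c] by auto
    qed
    finally show "c q = (\<Sum>s\<in>S. novikov_smult act (b s) (generator (p s))) q" by simp
  qed
  then have "d c = d (\<Sum>s\<in>S. novikov_smult act (b s) (generator (p s)))"
    by (rule arg_cong)
  also have "\<dots> = (\<Sum>s\<in>S. d (novikov_smult act (b s) (generator (p s))))"
    by (rule conjunct2[OF d_sum[OF finite_base]]) (rule chain)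
  also have "\<dots> = (\<Sum>s\<in>S. novikov_smult act (b s) (matrix_row P n (p s)))"
    using b p by (intro sum.cong) (simp_all add: d_smult d_generator generator_chain)
  finally show "d c = \<dots>" .
qed

text \<open>
  On a generator \<open>d\<close> lowers the action, and by the decomposition \<open>d c\<close> only involves terms occurring in
  the rows of elements of the support of \<open>c\<close>. It follows that \<open>d\<close> is continuous: a chain and
  an approximation of it have boundaries that agree above the level of the error.
\<close>

lemma d_below:
  assumes c: "c \<in> floer_chains P A" and L: "below L c"
  shows "below L (d c)"
  unfolding below_def
proof (intro allI impI)
  fix q assume q: "d c q \<noteq> 0"
  have "\<forall>s. \<exists>p. s \<in> S \<longrightarrow> p \<in> P \<and> \<pi> p = s" using projection_onto by blast
  then obtain p where p: "\<And>s. s \<in> S \<Longrightarrow> p s \<in> P \<and> \<pi> (p s) = s" by metis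
  let ?b = "\<lambda>s g. if g \<in> carrier \<Gamma> then c (act g (p s)) else 0"
  have "(\<Sum>s\<in>S. novikov_smult act (?b s) (matrix_row P n (p s)) q) \<noteq> 0"
    using q chain_decomposition(2)[OF c p] by (simp add: sum_fun_apply)
  then obtain s where s: "s \<in> S" "novikov_smult act (?b s) (matrix_row P n (p s)) q \<noteq> 0"
    by (meson sum.not_neutral_contains_not_neutral)
  then obtain g p' where g: "?b s g \<noteq> 0" "matrix_row P n (p s) p' \<noteq> 0" "act g p' = q"
    unfolding novikov_smult_def by (auto elim: sum.not_neutral_contains_not_neutral)
  then have g': "g \<in> carrier \<Gamma>" "c (act g (p s)) \<noteq> 0" "p' \<in> P" "n (p s) p' \<noteq> 0"
    by (auto simp: matrix_row_def split: if_splits)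
  then have "A p' < A (p s)" using n_decreasing[of "p s" p'] p[OF s(1)] by auto
  then have "A q < A (act g (p s))" using g g' p[OF s(1)] action_functional by auto
  then show "A q \<le> L" using L g'(2) by (force simp: below_def)
qed

section \<open>Finite sums of generators\<close>

lemma noetherian_adjoin_translations:
  assumes F: "finite F" "F \<subseteq> carrier \<Gamma>" and N: "noetherian_under (range scale) (N :: ('p \<Rightarrow> 'r) set)"
  shows "\<exists>M. N \<subseteq> M \<and> noetherian_under (range scale \<union> translate ` F) M"
  using F
proof (induction F rule: finite_induct)
  case empty
  then show ?case using N by auto
next
  case (insert g F)
  then obtain M where M: "N \<subseteq> M" "noetherian_under (range scale \<union> translate ` F) M" by auto
  have "commuting_operator (range scale \<union> translate ` F) (translate g) M"
    by unfold_locales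
      (use insert.prems M in \<open>auto simp: scale_diff translate_diff translate_scale translate_commute\<close>)
  then obtain M' where "M \<subseteq> M'"
      "noetherian_under (insert (translate g) (range scale \<union> translate ` F)) M'"
    using commuting_operator.noetherian_adjoin by blast
  then show ?case using M by (intro exI[of _ M']) auto
qed

lemma translate_generator:
  assumes "g \<in> carrier \<Gamma>" "p \<in> P"
  shows "translate g (generator p) = generator (act g p)"
proof
  fix q
  show "translate g (generator p) q = generator (act g p) q"
    using assms act_in act_inv_act act_act_inv
    by (auto simp: translate_def generator_def)
qed

text \<open>
  Start with the finite free module on one point per orbit and adjoin translations by the group
  generators and by their inverses. The translates of these points exhaust \<open>P\<close>, so the resulting module
  contains every finite sum of elements of \<open>P\<close>.
\<close>

lemma finite_chains_noetherian:
  assumes noeth: "noetherian_ring (ring_of_type :: 'r ring)"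
  shows "\<exists>E M. E \<subseteq> range scale \<union> translate ` carrier \<Gamma> \<and> noetherian_under E M \<and>
    {f. finite {q. f q \<noteq> 0} \<and> {q. f q \<noteq> 0} \<subseteq> P} \<subseteq> M"
proof -
  obtain F where F: "F \<subseteq> carrier \<Gamma>" "finite F" "generate \<Gamma> F = carrier \<Gamma>"
    using finitely_generated by blast
  have "\<forall>s. \<exists>p. s \<in> S \<longrightarrow> p \<in> P \<and> \<pi> p = s" using projection_onto by blast
  then obtain p where p: "\<And>s. s \<in> S \<Longrightarrow> p s \<in> P \<and> \<pi> (p s) = s" by metis
  let ?G = "F \<union> (\<lambda>g. inv g) ` F"
  let ?E = "range scale \<union> translate ` ?G"
  obtain M where M: "{f. \<forall>q. f q \<noteq> 0 \<longrightarrow> q \<in> p ` S} \<subseteq> M" "noetherian_under ?E M"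
    using noetherian_adjoin_translations[of ?G, OF _ _ noetherian_finite_support[OF noeth, of "p ` S"]]
      F finite_base by auto
  have closed: "op_closed ?E M" using M(2) by (simp add: noetherian_under_def)
  have translate: "\<forall>f\<in>M. {q. f q \<noteq> 0} \<subseteq> P \<longrightarrow> translate g f \<in> M" if "g \<in> generate \<Gamma> F" for g
    using that
  proof induction
    case one
    show ?case using translate_one by (metis (mono_tags, lifting) mem_Collect_eq subsetD)
  next
    case (incl h)
    then show ?case using op_closed_oper[OF closed, of "translate h"] by blast
  next
    case (inv h)
    then show ?case using op_closed_oper[OF closed, of "translate (inv h)"] by blast
  next
    case (eng g h)
    have "{q. translate h f q \<noteq> 0} \<subseteq> P" for f by (auto simp: translate_def)
    then show ?case using eng F(3) by (auto simp: translate_mult)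
  qed
  have gen: "generator q \<in> M" if q: "q \<in> P" for q
  proof -
    have s: "\<pi> q \<in> S" using q projection_onto by blast
    then obtain g where g: "g \<in> carrier \<Gamma>" "q = act g (p (\<pi> q))"
      using p[OF s] projection_fibres[of "p (\<pi> q)" q] q by auto
    have "generator (p (\<pi> q)) \<in> {f :: 'p \<Rightarrow> 'r. \<forall>q. f q \<noteq> 0 \<longrightarrow> q \<in> p ` S}"
      using s by (simp add: generator_def)
    then have "generator (p (\<pi> q)) \<in> M" using M(1) by blast
    moreover have "{x. generator (p (\<pi> q)) x \<noteq> (0::'r)} \<subseteq> P"
      using p[OF s] by (auto simp: generator_def)
    ultimately have "translate g (generator (p (\<pi> q))) \<in> M" using translate[of g] g(1) F(3) by blast
    then show ?thesis using translate_generator[of g "p (\<pi> q)"] g p[OF s] by simp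
  qed
  have "\<forall>f. {q. f q \<noteq> 0} \<subseteq> Q \<longrightarrow> f \<in> M" if "finite Q" "Q \<subseteq> P" for Q
    using that
  proof (induction Q rule: finite_induct)
    case empty
    have "f = 0" if "{q. f q \<noteq> 0} \<subseteq> {}" for f :: "'p \<Rightarrow> 'r" using that by (auto simp: fun_eq_iff)
    then show ?case using op_closed_zero[OF closed] by metis
  next
    case (insert p Q)
    show ?case
    proof (intro allI impI)
      fix f :: "'p \<Rightarrow> 'r" assume f: "{q. f q \<noteq> 0} \<subseteq> insert p Q"
      let ?g = "scale (f p) (generator p)"
      have "{q. (f - ?g) q \<noteq> 0} \<subseteq> Q" using f by (auto simp: scale_def generator_def split: if_splits)
      then have "f - ?g \<in> M" using insert by blast
      moreover have "?g \<in> M" using op_closed_oper[OF closed, of "scale (f p)"] gen[of p] insert by blast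
      ultimately have "(f - ?g) + ?g \<in> M" by (rule op_closed_add[OF closed])
      then show "f \<in> M" by simp
    qed
  qed
  moreover have "?E \<subseteq> range scale \<union> translate ` carrier \<Gamma>" using F(1) by auto
  ultimately show ?thesis using M(2) by (intro exI[of _ ?E] exI[of _ M]) blast
qed

end

section \<open>Discrete sets of action values\<close>

inductive_set nonneg_sums :: "real set \<Rightarrow> real set" for D where
  zero: "0 \<in> nonneg_sums D"
| add: "\<lbrakk>x \<in> D; y \<in> nonneg_sums D\<rbrakk> \<Longrightarrow> x + y \<in> nonneg_sums D"

lemma nonneg_sums_nonneg:
  assumes "\<And>x. x \<in> D \<Longrightarrow> 0 \<le> x" "y \<in> nonneg_sums D"
  shows "0 \<le> y"
  using assms(2) by induction (use assms(1) in fastforce)+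

lemma nonneg_sums_cases:
  assumes "\<And>x. x \<in> D \<Longrightarrow> 0 \<le> x" "y \<in> nonneg_sums D"
  shows "y = 0 \<or> (\<exists>x\<in>D. \<exists>z\<in>nonneg_sums D. 0 < x \<and> y = x + z)"
  using assms(2)
proof induction
  case (add x y)
  show ?case
  proof (cases "x = 0")
    case False
    then have "0 < x" using assms(1)[OF add.hyps(1)] by simp
    then show ?thesis using add.hyps by blast
  qed (use add.IH in simp)
qed simp

text \<open>
  A sum bounded by \<open>C\<close> has at most \<open>C / \<delta>\<close> nonzero summands, where \<open>\<delta>\<close> is a positive lower bound for the positive
  elements of \<open>D\<close>, and they come from a finite set.
\<close>

lemma nonneg_sums_finite:
  assumes fin: "\<And>C. finite {x \<in> D. x \<le> C}" and nonneg: "\<And>x. x \<in> D \<Longrightarrow> 0 \<le> x"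
  shows "finite {y \<in> nonneg_sums D. y \<le> C}"
proof -
  \<comment> \<open>Inserting \<open>1\<close> makes the minimum meaningful when \<open>D\<close> has no elements in \<open>(0, 1]\<close>.\<close>
  define \<delta> where "\<delta> = Min (insert 1 {x \<in> D. 0 < x \<and> x \<le> 1})"
  have fin1: "finite {x \<in> D. 0 < x \<and> x \<le> 1}" by (rule finite_subset[OF _ fin[of 1]]) auto
  have \<delta>0: "0 < \<delta>" unfolding \<delta>_def using fin1 by (subst Min_gr_iff) auto
  have \<delta>: "\<delta> \<le> x" if "x \<in> D" "0 < x" for x
  proof (cases "x \<le> 1")
    case True
    then show ?thesis unfolding \<delta>_def using fin1 that by (intro Min_le) auto
  next
    case False
    have "\<delta> \<le> 1" unfolding \<delta>_def using fin1 by (intro Min_le) auto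
    then show ?thesis using False by simp
  qed
  have "finite {y \<in> nonneg_sums D. y \<le> real k * \<delta>}" for k
  proof (induction k)
    case 0
    have "{y \<in> nonneg_sums D. y \<le> real 0 * \<delta>} \<subseteq> {0}"
      using nonneg_sums_nonneg[OF nonneg] by force
    then show ?case using finite_subset by blast
  next
    case (Suc k)
    let ?X = "{x \<in> D. x \<le> real (Suc k) * \<delta>}" and ?Y = "{y \<in> nonneg_sums D. y \<le> real k * \<delta>}"
    have "{y \<in> nonneg_sums D. y \<le> real (Suc k) * \<delta>} \<subseteq> insert 0 ((\<lambda>(x, y). x + y) ` (?X \<times> ?Y))"
    proof
      fix y assume y: "y \<in> {y \<in> nonneg_sums D. y \<le> real (Suc k) * \<delta>}"
      then consider "y = 0" | x z where "x \<in> D" "z \<in> nonneg_sums D" "0 < x" "y = x + z"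
        using nonneg_sums_cases[OF nonneg] by blast
      then show "y \<in> insert 0 ((\<lambda>(x, y). x + y) ` (?X \<times> ?Y))"
      proof cases
        case 2
        have "x \<in> ?X" using 2 y nonneg_sums_nonneg[OF nonneg 2(2)] by simp
        moreover have "z \<in> ?Y" using 2 y \<delta>[OF 2(1,3)] by (simp add: algebra_simps)
        ultimately show ?thesis using 2(4) by force
      qed simp
    qed
    moreover have "finite (insert 0 ((\<lambda>(x, y). x + y) ` (?X \<times> ?Y)))"
      using fin Suc by blast
    ultimately show ?case by (rule finite_subset)
  qed
  moreover obtain k where "C \<le> real k * \<delta>"
    using reals_Archimedean3[OF \<delta>0] less_imp_le by blast
  then have "{y \<in> nonneg_sums D. y \<le> C} \<subseteq> {y \<in> nonneg_sums D. y \<le> real k * \<delta>}" by auto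
  ultimately show ?thesis using finite_subset by blast
qed

section \<open>Division by boundaries\<close>

context filtered_floer_novikov_complex
begin

definition top_part :: "real \<Rightarrow> ('p \<Rightarrow> 'r) \<Rightarrow> ('p \<Rightarrow> 'r)" where
  "top_part L c = (\<lambda>q. if A q = L then c q else 0)"

lemma top_part_top_part: "top_part L (top_part L' c) = (if L = L' then top_part L c else 0)"
  by (auto simp: top_part_def fun_eq_iff)

lemma top_part_diff: "top_part L (c - c') = top_part L c - top_part L c'"
  by (auto simp: top_part_def fun_eq_iff)

lemma top_part_scale: "top_part L (scale r c) = scale r (top_part L c)"
  by (auto simp: top_part_def scale_def fun_eq_iff)

lemma top_part_translate:
  "g \<in> carrier \<Gamma> \<Longrightarrow> top_part L (translate g c) = translate g (top_part (L + \<omega> g) c)"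
  by (auto simp: top_part_def translate_def fun_eq_iff A_act_inv)

lemma top_part_finite:
  assumes "c \<in> floer_chains P A"
  shows "finite {q. top_part L c q \<noteq> 0} \<and> {q. top_part L c q \<noteq> 0} \<subseteq> P"
proof
  show "finite {q. top_part L c q \<noteq> 0}"
    by (rule finite_subset[OF _ chain_finite[OF assms, of "L - 1"]])
      (auto simp: top_part_def split: if_splits)
  show "{q. top_part L c q \<noteq> 0} \<subseteq> P"
    using chain_support[OF assms] by (auto simp: top_part_def split: if_splits)
qed

lemma chain_top:
  assumes "c \<in> floer_chains P A" "c \<noteq> 0"
  obtains p where "c p \<noteq> 0" "below (A p) c"
  using filtration_Max[OF assms] unfolding below_def by metis

lemma chain_bounded:
  assumes "c \<in> floer_chains P A"
  shows "\<exists>L. below L c"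
proof (cases "c = 0")
  case True
  then show ?thesis by (simp add: below_def)
next
  case False
  then show ?thesis using chain_top[OF assms] by metis
qed

lemma below_mono: "\<lbrakk>below L c; L \<le> L'\<rbrakk> \<Longrightarrow> below L' c"
  unfolding below_def by (meson order_trans)

lemma below_diff:
  assumes "below L c" "below L c'"
  shows "below L (c - c')"
  unfolding below_def
proof (intro allI impI)
  fix q assume "(c - c') q \<noteq> 0"
  then have "c q \<noteq> 0 \<or> c' q \<noteq> 0" by auto
  then show "A q \<le> L" using assms by (auto simp: below_def)
qed

text \<open>
  The Noetherian property enters here and makes \<open>M\<close> and \<open>D\<close> independent of the level \<open>L\<close> and of the boundary
  \<open>d k\<close>. Choose finitely many boundaries whose top parts generate all top parts. If \<open>d k\<close> has level
  \<open>L\<close>, its top part is an \<open>R[\<Gamma>]\<close>-combination of the chosen ones; only those monomials count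
  that move a chosen top part exactly to level \<open>L\<close>. Such a monomial shifts the whole boundary by the same amount, so
  differences of actions, and with them \<open>D\<close> and \<open>M\<close>, are preserved.
\<close>

lemma uniform_division_step:
  assumes noeth: "noetherian_ring (ring_of_type :: 'r ring)"
  shows "\<exists>M D. (\<forall>C. finite {x \<in> D. x \<le> C}) \<and> (\<forall>x\<in>D. 0 \<le> x) \<and>
    (\<forall>L. \<forall>k\<in>floer_chains P A. below L (d k) \<longrightarrow>
      (\<exists>h\<in>floer_chains P A. below (L + M) h \<and> (\<forall>q. d h q \<noteq> 0 \<longrightarrow> L - A q \<in> D) \<and>
        top_part L (d h) = top_part L (d k)))"
proof -
  obtain E N where E: "E \<subseteq> range scale \<union> translate ` carrier \<Gamma>" and N: "noetherian_under E N"
    and sub: "{f. finite {q. f q \<noteq> 0} \<and> {q. f q \<noteq> 0} \<subseteq> P} \<subseteq> N"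
    using finite_chains_noetherian[OF noeth] by blast
  define X where "X = {top_part L (d k) | L k. k \<in> floer_chains P A \<and> below L (d k)}"
  have XN: "X \<subseteq> N"
  proof
    fix x assume "x \<in> X"
    then obtain L k where k: "k \<in> floer_chains P A" "x = top_part L (d k)" unfolding X_def by blast
    show "x \<in> N" unfolding k(2)
      by (rule subsetD[OF sub], rule CollectI, rule top_part_finite[OF d_chain[OF k(1)]])
  qed
  obtain F where F: "finite F" "F \<subseteq> X" "X \<subseteq> op_span E F"
    using noetherian_under_generators[OF N XN] by - (elim exE conjE, rule that)
  have "\<forall>x. \<exists>L k. x \<in> F \<longrightarrow> x = top_part L (d k) \<and> k \<in> floer_chains P A \<and> below L (d k)"
    using F(2) unfolding X_def by blast
  then obtain L k where Lk: "\<And>x. x \<in> F \<Longrightarrow> x = top_part (L x) (d (k x))"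
    "\<And>x. x \<in> F \<Longrightarrow> k x \<in> floer_chains P A" "\<And>x. x \<in> F \<Longrightarrow> below (L x) (d (k x))"
    by metis
  have "\<forall>x. \<exists>m. x \<in> F \<longrightarrow> below m (k x)" using Lk(2) chain_bounded by blast
  then obtain m where m: "\<And>x. x \<in> F \<Longrightarrow> below (m x) (k x)" by metis
  define M where "M = Max (insert 0 ((\<lambda>x. m x - L x) ` F))"
  have M: "m x \<le> L x + M" if "x \<in> F" for x
  proof -
    have "m x - L x \<le> M" unfolding M_def using F(1) that by (intro Max_ge) auto
    then show ?thesis by simp
  qed
  define D where "D = (\<Union>x\<in>F. {L x - A q | q. d (k x) q \<noteq> 0})"
  have fin: "finite {y \<in> D. y \<le> C}" for C
  proof (rule finite_subset)
    show "{y \<in> D. y \<le> C} \<subseteq> (\<Union>x\<in>F. (\<lambda>q. L x - A q) ` {q. d (k x) q \<noteq> 0 \<and> A q > L x - C - 1})"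
      by (fastforce simp: D_def)
    show "finite (\<Union>x\<in>F. (\<lambda>q. L x - A q) ` {q. d (k x) q \<noteq> 0 \<and> A q > L x - C - 1})"
      using F(1) Lk(2) d_chain chain_finite by (intro finite_UN_I finite_imageI) blast+
  qed
  have nonneg: "0 \<le> y" if "y \<in> D" for y using that Lk(3) by (auto simp: D_def below_def)
  \<comment> \<open>Sorting an arbitrary combination by levels: for each level \<open>l\<close> the part of \<open>f\<close> of action \<open>l\<close> is realised.\<close>
  have claim: "\<exists>h\<in>floer_chains P A. below (l + M) h \<and> (\<forall>q. d h q \<noteq> 0 \<longrightarrow> l - A q \<in> D) \<and>
      top_part l (d h) = top_part l f" if "f \<in> op_span E F" for f l
    using that
  proof (induction arbitrary: l)
    case zero
    show ?case
      by (rule bexI[OF _ floer_chains_zero], unfold d_zero) (simp add: below_def)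
  next
    case (base x)
    show ?case
    proof (cases "l = L x")
      case True
      have "below (l + M) (k x)" using below_mono[OF m[OF base] M[OF base]] True by simp
      moreover have "top_part l (d (k x)) = top_part l x"
        using Lk(1)[OF base] True by (metis top_part_top_part)
      ultimately show ?thesis using Lk(2)[OF base] base True by (intro bexI[of _ "k x"]) (auto simp: D_def)
    next
      case False
      have "top_part l x = 0" using Lk(1)[OF base] False by (metis top_part_top_part)
      then have "top_part l (d 0) = top_part l x" unfolding d_zero by (simp add: top_part_def fun_eq_iff)
      moreover have "below (l + M) 0" by (simp add: below_def)
      moreover have "\<forall>q. d 0 q \<noteq> 0 \<longrightarrow> l - A q \<in> D" unfolding d_zero by simp
      ultimately show ?thesis using floer_chains_zero by blast
    qed
  next
    case (diff f f')
    obtain h h' where h: "h \<in> floer_chains P A" "below (l + M) h" "\<forall>q. d h q \<noteq> 0 \<longrightarrow> l - A q \<in> D"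
        "top_part l (d h) = top_part l f"
      and h': "h' \<in> floer_chains P A" "below (l + M) h'" "\<forall>q. d h' q \<noteq> 0 \<longrightarrow> l - A q \<in> D"
        "top_part l (d h') = top_part l f'"
      using diff.IH by meson
    have "l - A q \<in> D" if "d (h - h') q \<noteq> 0" for q
      using that h(3) h'(3) by (cases "d h q = 0") (auto simp: d_diff[OF h(1) h'(1)])
    moreover have "top_part l (d (h - h')) = top_part l (f - f')"
      unfolding d_diff[OF h(1) h'(1)] top_part_diff h(4) h'(4) by (rule refl)
    ultimately show ?case
      using below_diff[OF h(2) h'(2)] floer_chains_diff[OF h(1) h'(1)] by blast
  next
    case (oper e f)
    from oper.hyps(1) E consider r where "e = scale r" | g where "g \<in> carrier \<Gamma>" "e = translate g"
      by blast
    then show ?case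
    proof cases
      case 1
      obtain h where h: "h \<in> floer_chains P A" "below (l + M) h" "\<forall>q. d h q \<noteq> 0 \<longrightarrow> l - A q \<in> D"
        "top_part l (d h) = top_part l f"
        using oper.IH by meson
      have "below (l + M) (scale r h)" 
        unfolding below_def by (intro allI impI, drule scale_nonzero) (use h(2) below_def in blast)
      moreover have "\<forall>q. d (scale r h) q \<noteq> 0 \<longrightarrow> l - A q \<in> D"
        unfolding d_scale[OF h(1)] by (intro allI impI, drule scale_nonzero) (use h(3) in blast)
      moreover have "top_part l (d (scale r h)) = top_part l (e f)"
        by (simp add: d_scale[OF h(1)] top_part_scale h(4) 1)
      ultimately show ?thesis using scale_chain[OF h(1)] by blast
    next
      case 2
      obtain h where h: "h \<in> floer_chains P A" "below (l + \<omega> g + M) h"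
        "\<forall>q. d h q \<noteq> 0 \<longrightarrow> l + \<omega> g - A q \<in> D" "top_part (l + \<omega> g) (d h) = top_part (l + \<omega> g) f"
        using oper.IH by meson
      have "below (l + M) (translate g h)"
        unfolding below_def
      proof (intro allI impI)
        fix q assume "translate g h q \<noteq> 0"
        with 2(1) show "A q \<le> l + M"
          by (rule translate_nonzero) (use h(2) in \<open>force simp: below_def\<close>)
      qed
      moreover have "l - A q \<in> D" if "d (translate g h) q \<noteq> 0" for q
      proof -
        have "translate g (d h) q \<noteq> 0" using that d_translate[OF 2(1) h(1)] by simp
        with 2(1) show ?thesis
        proof (rule translate_nonzero)
          assume "d h (act (inv g) q) \<noteq> 0" "A (act (inv g) q) = A q + \<omega> g"
          then show ?thesis using h(3) by force
        qed
      qed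
      moreover have "top_part l (d (translate g h)) = top_part l (e f)"
        by (simp add: d_translate[OF 2(1) h(1)] top_part_translate[OF 2(1)] h(4) 2(2))
      ultimately show ?thesis using translate_chain[OF 2(1) h(1)] by blast
    qed
  qed
  have "\<exists>h\<in>floer_chains P A. below (l + M) h \<and> (\<forall>q. d h q \<noteq> 0 \<longrightarrow> l - A q \<in> D) \<and>
      top_part l (d h) = top_part l (d k')" if "k' \<in> floer_chains P A" "below l (d k')" for l k'
  proof -
    have "top_part l (d k') \<in> op_span E F" using F(3) that by (auto simp: X_def)
    then show ?thesis using claim[of "top_part l (d k')" l] by (simp add: top_part_top_part)
  qed
  then show ?thesis using fin nonneg by blast
qed

text \<open>
  Membership in the closure of the image of \<open>d\<close> for the topology given by the filtration.
\<close>

definition boundary_limit :: "('p \<Rightarrow> 'r) \<Rightarrow> bool" where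
  "boundary_limit c \<longleftrightarrow>
     c \<in> floer_chains P A \<and> (\<forall>L. \<exists>k\<in>floer_chains P A. below L (c - d k))"

lemma boundary_limit_diff:
  assumes c: "boundary_limit c" and h: "h \<in> floer_chains P A"
  shows "boundary_limit (c - d h)"
  unfolding boundary_limit_def
proof (intro conjI allI)
  show "c - d h \<in> floer_chains P A"
    using c h by (auto simp: boundary_limit_def intro: floer_chains_diff d_chain)
  fix L
  obtain k where k: "k \<in> floer_chains P A" "below L (c - d k)"
    using c by (auto simp: boundary_limit_def)
  have "c - d h - d (k - h) = c - d k" by (simp add: d_diff[OF k(1) h])
  then have "below L (c - d h - d (k - h))" using k(2) by (simp only:)
  then show "\<exists>k\<in>floer_chains P A. below L (c - d h - d k)"
    using floer_chains_diff[OF k(1) h] by (rule bexI)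
qed

text \<open>
  One division step, stated without mentioning the level of \<open>u\<close>, so that \<open>u = 0\<close> is included. The last clause
  says that the level drops strictly.
\<close>

lemma division_step:
  assumes noeth: "noetherian_ring (ring_of_type :: 'r ring)"
  shows "\<exists>M D. (\<forall>C. finite {x \<in> D. x \<le> C}) \<and> (\<forall>x\<in>D. 0 \<le> x) \<and>
    (\<forall>u. boundary_limit u \<longrightarrow> (\<exists>h\<in>floer_chains P A.
      (\<forall>L. below L u \<longrightarrow> below (L + M) h) \<and>
      (\<forall>q. d h q \<noteq> 0 \<longrightarrow> (\<exists>p. u p \<noteq> 0 \<and> A p - A q \<in> D)) \<and>
      (\<forall>p. u p \<noteq> 0 \<longrightarrow> below (A p) u \<longrightarrow> (\<forall>q. (u - d h) q \<noteq> 0 \<longrightarrow> A q < A p))))"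
proof -
  obtain M D where fin: "\<forall>C. finite {x \<in> D. x \<le> C}" and nonneg: "\<forall>x\<in>D. 0 \<le> x" and
    step: "\<forall>L. \<forall>k\<in>floer_chains P A. below L (d k) \<longrightarrow>
      (\<exists>h\<in>floer_chains P A. below (L + M) h \<and> (\<forall>q. d h q \<noteq> 0 \<longrightarrow> L - A q \<in> D) \<and>
        top_part L (d h) = top_part L (d k))"
    using uniform_division_step[OF noeth] by - (elim exE conjE, rule that)
  have "\<exists>h\<in>floer_chains P A. (\<forall>L. below L u \<longrightarrow> below (L + M) h) \<and>
      (\<forall>q. d h q \<noteq> 0 \<longrightarrow> (\<exists>p. u p \<noteq> 0 \<and> A p - A q \<in> D)) \<and>
      (\<forall>p. u p \<noteq> 0 \<longrightarrow> below (A p) u \<longrightarrow> (\<forall>q. (u - d h) q \<noteq> 0 \<longrightarrow> A q < A p))"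
    if u: "boundary_limit u" for u
  proof (cases "u = 0")
    case True
    then show ?thesis by (intro bexI[of _ 0]) (simp_all add: floer_chains_zero below_def d_zero)
  next
    case False
    have uC: "u \<in> floer_chains P A" using u by (simp add: boundary_limit_def)
    obtain p where p: "u p \<noteq> 0" "below (A p) u" using chain_top[OF uC False] .
    obtain k where k: "k \<in> floer_chains P A" "below (A p - 1) (u - d k)"
      using u unfolding boundary_limit_def by blast
    \<comment> \<open>Approximating \<open>u\<close> to within its level minus \<open>1\<close> gives a boundary with the same top part.\<close>
    have eq: "d k q = u q" if "A q > A p - 1" for q
    proof (rule ccontr)
      assume "d k q \<noteq> u q"
      then have "(u - d k) q \<noteq> 0" by simp
      then show False using k(2) that unfolding below_def by force
    qed
    have "below (A p) (d k)"
      unfolding below_def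
    proof (intro allI impI)
      fix q assume q: "d k q \<noteq> 0"
      show "A q \<le> A p"
      proof (cases "A q > A p - 1")
        case True
        then show ?thesis using q eq p(2) by (auto simp: below_def)
      qed simp
    qed
    then obtain h where h: "h \<in> floer_chains P A" "below (A p + M) h"
      "\<forall>q. d h q \<noteq> 0 \<longrightarrow> A p - A q \<in> D" "top_part (A p) (d h) = top_part (A p) (d k)"
      using step[rule_format, OF k(1)] by meson
    have "\<forall>L. below L u \<longrightarrow> below (L + M) h"
    proof (intro allI impI)
      fix L assume "below L u"
      then have "A p \<le> L" using p(1) by (simp add: below_def)
      then show "below (L + M) h" using below_mono[OF h(2)] by simp
    qed
    moreover have "\<forall>q. d h q \<noteq> 0 \<longrightarrow> (\<exists>p. u p \<noteq> 0 \<and> A p - A q \<in> D)" using h(3) p(1) by blast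
    moreover have "A q < A p'" if p': "u p' \<noteq> 0" "below (A p') u" and q: "(u - d h) q \<noteq> 0" for p' q
    proof -
      have pp: "A p' = A p" using p p' by (simp add: below_def order_antisym)
      have "A q \<le> A p"
      proof (cases "u q = 0")
        case True
        then have "A p - A q \<in> D" using q h(3) by simp
        then show ?thesis using nonneg by force
      next
        case False
        then show ?thesis using p(2) by (simp add: below_def)
      qed
      moreover have "A q \<noteq> A p"
      proof
        assume "A q = A p"
        then have "d h q = u q" using fun_cong[OF h(4), of q] eq[of q] by (simp add: top_part_def)
        then show False using q by simp
      qed
      ultimately show ?thesis using pp by simp
    qed
    ultimately show ?thesis using h(1) by blast
  qed
  then show ?thesis using fin nonneg by blast
qed

text \<open>
  In particular the image of \<open>d\<close> is closed. The primitive is the sum of the chains chosen in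
  infinitely many division steps; above each action level only finitely many of them contribute.
\<close>

lemma boundary_limit_bounded_primitive:
  assumes noeth: "noetherian_ring (ring_of_type :: 'r ring)"
  shows "\<exists>M. \<forall>c. boundary_limit c \<longrightarrow>
    (\<exists>h\<in>floer_chains P A. d h = c \<and> (\<forall>L. below L c \<longrightarrow> below (L + M) h))"
proof -
  let ?Q = "\<lambda>M D u h. (\<forall>L. below L u \<longrightarrow> below (L + M) h) \<and>
      (\<forall>q. d h q \<noteq> 0 \<longrightarrow> (\<exists>p. u p \<noteq> 0 \<and> A p - A q \<in> D)) \<and>
      (\<forall>p. u p \<noteq> 0 \<longrightarrow> below (A p) u \<longrightarrow> (\<forall>q. (u - d h) q \<noteq> 0 \<longrightarrow> A q < A p))"
  obtain M D where fin': "\<forall>C. finite {x \<in> D. x \<le> C}" and nonneg': "\<forall>x\<in>D. 0 \<le> x" and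
    step: "\<forall>u. boundary_limit u \<longrightarrow> (\<exists>h\<in>floer_chains P A. ?Q M D u h)"
    using division_step[OF noeth] by - (elim exE conjE, rule that)
  note fin = fin'[rule_format] and nonneg = nonneg'[rule_format]
  have "\<forall>u. \<exists>h. boundary_limit u \<longrightarrow> h \<in> floer_chains P A \<and> ?Q M D u h"
    using step by (simp only: Bex_def ex_simps)
  then obtain H where "\<forall>u. boundary_limit u \<longrightarrow> H u \<in> floer_chains P A \<and> ?Q M D u (H u)"
    by - (drule choice, elim exE, rule that)
  then have H: "\<And>u. boundary_limit u \<Longrightarrow> H u \<in> floer_chains P A"
    and H_below: "\<And>u L. \<lbrakk>boundary_limit u; below L u\<rbrakk> \<Longrightarrow> below (L + M) (H u)"
    and H_D: "\<And>u q. \<lbrakk>boundary_limit u; d (H u) q \<noteq> 0\<rbrakk> \<Longrightarrow> \<exists>p. u p \<noteq> 0 \<and> A p - A q \<in> D"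
    and H_less: "\<And>u p q. \<lbrakk>boundary_limit u; u p \<noteq> 0; below (A p) u; (u - d (H u)) q \<noteq> 0\<rbrakk> \<Longrightarrow> A q < A p"
    by (blast, blast, blast, blast)
  have "\<exists>h\<in>floer_chains P A. d h = c \<and> (\<forall>L. below L c \<longrightarrow> below (L + M) h)"
    if c: "boundary_limit c" for c
  proof -
    define u where "u = rec_nat c (\<lambda>_ v. v - d (H v))"
    have u0: "u 0 = c" and uSuc: "u (Suc i) = u i - d (H (u i))" for i by (simp_all add: u_def)
    have lim: "boundary_limit (u i)" for i
    proof (induction i)
      case 0
      show ?case unfolding u0 by (rule c)
    next
      case (Suc i)
      show ?case unfolding uSuc by (rule boundary_limit_diff[OF Suc H[OF Suc]])
    qed
    have uC: "u i \<in> floer_chains P A" for i using lim by (simp add: boundary_limit_def)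

    \<comment> \<open>All actions occurring in some remainder lie in \<open>T\<close>, which is finite above every bound.\<close>
    define T where "T = {A p - y | p y. c p \<noteq> 0 \<and> y \<in> nonneg_sums D}"
    have uT: "A q \<in> T" if "u i q \<noteq> 0" for i q
      using that
    proof (induction i arbitrary: q)
      case 0
      then show ?case unfolding T_def u0 using nonneg_sums.zero by force
    next
      case (Suc i)
      show ?case
      proof (cases "u i q = 0")
        case True
        then have "d (H (u i)) q \<noteq> 0" using Suc.prems by (simp add: uSuc)
        then obtain p where p: "u i p \<noteq> 0" "A p - A q \<in> D" using H_D[OF lim] by blast
        then obtain p' y where y: "A p = A p' - y" "c p' \<noteq> 0" "y \<in> nonneg_sums D"
          using Suc.IH[OF p(1)] unfolding T_def by blast
        have "A q = A p' - ((A p - A q) + y)" using y(1) by simp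
        then show ?thesis unfolding T_def using y(2,3) nonneg_sums.add[OF p(2)] by blast
      qed (rule Suc.IH)
    qed
    have T_fin: "finite {t \<in> T. t > L}" for L
    proof -
      obtain m where m: "below m c" using chain_bounded[OF uC[of 0]] unfolding u0 by blast
      let ?X = "{p. c p \<noteq> 0 \<and> A p > L}" and ?Y = "{y \<in> nonneg_sums D. y \<le> m - L}"
      have "{t \<in> T. t > L} \<subseteq> (\<lambda>(p, y). A p - y) ` (?X \<times> ?Y)"
      proof
        fix t assume "t \<in> {t \<in> T. t > L}"
        then obtain p y where py: "t = A p - y" "c p \<noteq> 0" "y \<in> nonneg_sums D" "A p - y > L"
          unfolding T_def by blast
        have "0 \<le> y" by (rule nonneg_sums_nonneg[OF nonneg py(3)])
        moreover have "A p \<le> m" using m py(2) by (simp add: below_def)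
        ultimately have "(p, y) \<in> ?X \<times> ?Y" using py by auto
        then show "t \<in> (\<lambda>(p, y). A p - y) ` (?X \<times> ?Y)" using py(1) by force
      qed
      moreover have "finite (?X \<times> ?Y)"
        using chain_finite[OF uC[of 0], of L] nonneg_sums_finite[OF fin nonneg] unfolding u0 by blast
      ultimately show ?thesis using finite_surj by blast
    qed
    have below_Suc: "below L (u (Suc i))" if L: "below L (u i)" for L i
    proof (cases "u i = 0")
      case True
      have "below l (d (H (u i)))" for l
        using H_D[OF lim, of i] True by (auto simp: below_def)
      then show ?thesis unfolding uSuc by (rule below_diff[OF L])
    next
      case False
      then obtain p where p: "u i p \<noteq> 0" "below (A p) (u i)" using chain_top[OF uC] by blast
      then have "A p \<le> L" using L by (simp add: below_def)
      then show ?thesis using H_less[OF lim p] unfolding below_def uSuc by force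
    qed
    have below_later: "below L (u j)" if "below L (u i)" "i \<le> j" for L i j
      using that(2,1) by (induction rule: dec_induct) (auto intro: below_Suc)
    \<comment> \<open>Otherwise the levels of the remainders would be infinitely many elements of \<open>T\<close> above \<open>L\<close>.\<close>
    have eventually_below: "\<exists>i. below L (u i)" for L
    proof (rule ccontr)
      assume no: "\<not> (\<exists>i. below L (u i))"
      then have nz: "u i \<noteq> 0" for i by (metis below_def zero_fun_apply)
      have "\<forall>i. \<exists>p. u i p \<noteq> 0 \<and> below (A p) (u i)" using chain_top[OF uC nz] by metis
      then obtain p where p: "\<And>i. u i (p i) \<noteq> 0" "\<And>i. below (A (p i)) (u i)" by metis
      have "A (p (Suc i)) < A (p i)" for i using H_less[OF lim p] p(1)[of "Suc i"] by (simp add: uSuc)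
      then have "strict_mono (\<lambda>i. - A (p i))" by (simp add: strict_mono_Suc_iff)
      then have "inj (\<lambda>i. - A (p i))" by (rule strict_mono_imp_inj_on)
      then have "inj (\<lambda>i. A (p i))" by (simp add: inj_def)
      moreover have "A (p i) > L" for i using no p(2) below_mono by (metis not_less)
      then have "range (\<lambda>i. A (p i)) \<subseteq> {t \<in> T. t > L}" using uT p(1) by blast
      ultimately show False using T_fin[of L] by (meson finite_subset range_inj_infinite)
    qed

    define s where "s i = (\<Sum>j<i. H (u j))" for i
    have s_chain: "s i \<in> floer_chains P A \<and> d (s i) = c - u i" for i
    proof (induction i)
      case 0
      show ?case
        unfolding s_def lessThan_0 sum.empty u0 d_zero diff_self using floer_chains_zero by blast
    next
      case (Suc i)
      have "s (Suc i) = s i + H (u i)" by (simp add: s_def)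
      moreover have "d (s i + H (u i)) = c - u (Suc i)"
        using Suc d_add[of "s i" "H (u i)"] H[OF lim] by (simp add: uSuc fun_eq_iff)
      ultimately show ?case using Suc H[OF lim] floer_chains_add by metis
    qed
    have s_stable: "s j q = s i q" if "below L (u i)" "i \<le> j" "A q > L + M" for i j q L
      using that(2)
    proof (induction rule: dec_induct)
      case (step j)
      have "below (L + M) (H (u j))" using H_below[OF lim below_later[OF that(1) step.hyps(1)]] .
      then have "H (u j) q = 0" using that(3) unfolding below_def by (meson not_less)
      then show ?case using step.IH by (simp add: s_def)
    qed simp
    obtain K where K: "\<And>L. below L (u (K L))" using eventually_below by metis
    \<comment> \<open>From stage \<open>K (A q - M - 1)\<close> on, the chosen chains have level below \<open>A q\<close>, so the coefficient at \<open>q\<close> is final.\<close>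
    define h where "h q = s (K (A q - M - 1)) q" for q
    have h_eq: "h q = s i q" if "below L (u i)" "A q > L + M" for L i q
    proof -
      let ?k = "K (A q - M - 1)"
      have "s (max i ?k) q = s i q" by (rule s_stable[OF that(1) _ that(2)]) simp
      moreover have "s (max i ?k) q = s ?k q" by (rule s_stable[OF K]) simp_all
      ultimately show ?thesis by (simp add: h_def)
    qed
    have hC: "h \<in> floer_chains P A"
    proof -
      have "finite {q. h q \<noteq> 0 \<and> A q > L}" for L
      proof -
        obtain i where i: "below (L - M) (u i)" using eventually_below by blast
        have "{q. h q \<noteq> 0 \<and> A q > L} \<subseteq> {q. s i q \<noteq> 0 \<and> A q > L}" using h_eq[OF i] by auto
        then show ?thesis using chain_finite s_chain finite_subset by blast
      qed
      moreover have "q \<in> P" if "h q \<noteq> 0" for q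
        using that s_chain chain_support unfolding h_def by blast
      ultimately show ?thesis unfolding floer_chains_def by blast
    qed
    have "d h = c"
    proof
      fix q
      \<comment> \<open>Low enough that neither the remainder nor the tail of the series for \<open>h\<close> reaches the action of \<open>q\<close>.\<close>
      obtain i where i: "below (A q - 1 - \<bar>M\<bar>) (u i)" using eventually_below by blast
      have "below (A q - 1) (h - s i)"
        unfolding below_def
      proof (intro allI impI)
        fix q' assume "(h - s i) q' \<noteq> 0"
        then have "\<not> A q' > A q - 1 - \<bar>M\<bar> + M" using h_eq[OF i] by auto
        then show "A q' \<le> A q - 1" by simp
      qed
      then have "below (A q - 1) (d (h - s i))"
        using floer_chains_diff[OF hC] s_chain by (intro d_below) blast+
      then have "d (h - s i) q = 0" unfolding below_def by force
      then have "d h q = d (s i) q" using d_diff[OF hC, of "s i"] s_chain by simp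
      moreover have "u i q = 0" using i unfolding below_def by force
      ultimately show "d h q = c q" using s_chain[of i] by simp
    qed
    moreover have "below (L + M) h" if "below L c" for L
      unfolding below_def
    proof (intro allI impI)
      fix q assume q: "h q \<noteq> 0"
      show "A q \<le> L + M"
      proof (rule ccontr)
        assume "\<not> A q \<le> L + M"
        then have "h q = s 0 q" using h_eq[of L 0 q] that by (simp add: u0)
        then show False using q by (simp add: s_def)
      qed
    qed
    ultimately show ?thesis using hC by blast
  qed
  then show ?thesis by blast
qed

section \<open>Spectral numbers and boundary depth\<close>

lemma filtration_le_iff_below:
  "c \<in> floer_chains P A \<Longrightarrow> filtration A c \<le> ereal L \<longleftrightarrow> below L c"
  by (simp add: filtration_le_iff below_def)

lemma homology_class_eqD:
  assumes "c \<in> floer_chains P A" "d c = 0" "c' \<in> floer_chains P A" "d c' = 0"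
    and "homology_class d (floer_chains P A) c = homology_class d (floer_chains P A) c'"
  shows "\<exists>k\<in>floer_chains P A. c - c' = d k"
proof -
  have "(c, c') \<in> homology_rel d (floer_chains P A)"
    using assms equiv_homology_rel eq_equiv_class[of "homology_rel d (floer_chains P A)" c c']
    unfolding homology_class_def by blast
  then show ?thesis unfolding homology_rel_def by blast
qed

lemma boundary_homology_class:
  assumes "h \<in> floer_chains P A"
  shows "homology_class d (floer_chains P A) (d h) = homology_class d (floer_chains P A) 0"
proof -
  have "(d h, 0) \<in> homology_rel d (floer_chains P A)"
    using assms by (simp add: homology_rel_def d_chain floer_chains_zero d_d d_zero)
  then show ?thesis
    unfolding homology_class_def using equiv_homology_rel equiv_class_eq by metis
qed

lemma spectral_number_finite:
  assumes noeth: "noetherian_ring (ring_of_type :: 'r ring)"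
    and a: "a \<in> homology d (floer_chains P A)" "a \<noteq> homology_class d (floer_chains P A) 0"
  shows "spectral_number P A d a > -\<infinity>"
proof (rule ccontr)
  let ?C = "floer_chains P A"
  assume "\<not> spectral_number P A d a > -\<infinity>"
  then have inf: "spectral_number P A d a = -\<infinity>" by simp
  obtain c where c: "c \<in> ?C" "d c = 0" "a = homology_class d ?C c"
    using a(1) unfolding homology_def homology_class_def quotient_def by blast
  have "\<exists>k\<in>?C. below L (c - d k)" for L
  proof -
    have "Inf (filtration A ` {c \<in> ?C. d c = 0 \<and> homology_class d ?C c = a}) < ereal L"
      unfolding spectral_number_eq_Inf_filtration[OF a(1), symmetric] inf by simp
    then obtain c' where c': "c' \<in> ?C" "d c' = 0" "homology_class d ?C c' = a" "filtration A c' < ereal L"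
      unfolding Inf_less_iff by blast
    obtain k where k: "k \<in> ?C" "c - c' = d k" using homology_class_eqD c c'(1-3) by metis
    have "c - d k = c'" by (simp flip: k(2))
    then show ?thesis using filtration_le_iff_below[OF c'(1), of L] c'(4) k(1) by auto
  qed
  then have "boundary_limit c" using c(1) by (simp add: boundary_limit_def)
  then obtain h where "h \<in> ?C" "d h = c" using boundary_limit_bounded_primitive[OF noeth] by blast
  then show False using boundary_homology_class a(2) c(3) by blast
qed

lemma boundary_depth_finite:
  assumes noeth: "noetherian_ring (ring_of_type :: 'r ring)"
  shows "\<exists>M::real. \<forall>c \<in> floer_chains P A.
    d c = 0 \<and> homology_class d (floer_chains P A) c = homology_class d (floer_chains P A) 0
    \<longrightarrow> (\<exists>h \<in> floer_chains P A. d h = c \<and> filtration A h \<le> filtration A c + ereal M)"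
proof -
  obtain M where M: "\<And>c. boundary_limit c \<Longrightarrow>
      \<exists>h\<in>floer_chains P A. d h = c \<and> (\<forall>L. below L c \<longrightarrow> below (L + M) h)"
    using boundary_limit_bounded_primitive[OF noeth] by blast
  have "\<exists>h \<in> floer_chains P A. d h = c \<and> filtration A h \<le> filtration A c + ereal M"
    if c: "c \<in> floer_chains P A" "d c = 0"
      "homology_class d (floer_chains P A) c = homology_class d (floer_chains P A) 0" for c
  proof (cases "c = 0")
    case True
    then show ?thesis by (intro bexI[of _ 0]) (simp_all add: d_zero floer_chains_zero filtration_def)
  next
    case False
    obtain k where k: "k \<in> floer_chains P A" "c - 0 = d k"
      using homology_class_eqD[OF c(1,2) floer_chains_zero d_zero c(3)] by blast
    have "below L (c - d k)" for L using k(2) by (simp add: below_def)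
    then have "boundary_limit c" unfolding boundary_limit_def using c(1) k(1) by blast
    then obtain h where h: "h \<in> floer_chains P A" "d h = c" "\<And>L. below L c \<Longrightarrow> below (L + M) h"
      using M by blast
    obtain p where p: "filtration A c = ereal (A p)" using filtration_Max[OF c(1) False] by blast
    then have "below (A p + M) h" using h(3) filtration_le_iff_below[OF c(1), of "A p"] by simp
    then have "filtration A h \<le> filtration A c + ereal M"
      using filtration_le_iff_below[OF h(1), of "A p + M"] p by simp
    then show ?thesis using h by blast
  qed
  then show ?thesis by blast
qed

end

theorem theorem1p3:
  fixes \<Gamma> :: "('g, 'm) monoid_scheme"
    and P :: "'p set"
    and act :: "'g \<Rightarrow> 'p \<Rightarrow> 'p"
    and S :: "'s set"
    and \<pi> :: "'p \<Rightarrow> 's"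
    and A :: "'p \<Rightarrow> real"
    and \<omega> :: "'g \<Rightarrow> real"
    and n :: "'p \<Rightarrow> 'p \<Rightarrow> 'r::{comm_ring,comm_monoid_mult}"
    and d :: "('p \<Rightarrow> 'r) \<Rightarrow> ('p \<Rightarrow> 'r)"
  assumes "noetherian_ring (ring_of_type :: 'r ring)"
    and "filtered_floer_novikov_complex \<Gamma> P act S \<pi> A \<omega> n d"
  shows "(\<forall>a \<in> homology d (floer_chains P A).
            a \<noteq> homology_class d (floer_chains P A) 0 \<longrightarrow> spectral_number P A d a > -\<infinity>)
       \<and> (\<exists>M::real. \<forall>c \<in> floer_chains P A.
            d c = 0 \<and> homology_class d (floer_chains P A) c = homology_class d (floer_chains P A) 0
            \<longrightarrow> (\<exists>h \<in> floer_chains P A. d h = c \<and> filtration A h \<le> filtration A c + ereal M))"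
proof -
  interpret filtered_floer_novikov_complex \<Gamma> P act S \<pi> A \<omega> n d by (rule assms(2))
  show ?thesis
    using spectral_number_finite[OF assms(1)] boundary_depth_finite[OF assms(1)] by blast
qed

end
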